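(* Let $\Sigma$ be an oriented smooth 3-manifold with boundary, $\imath_\partial:\partial\Sigma\hookrightarrow\Sigma$ the inclusion, and let $\alpha_1,\dots,\alpha_5\in\mathbb{R}$ with $\alpha_1\neq\alpha_2$ and $4\alpha_2\alpha_3-\alpha_5^2\neq0$. Let $A^i(t),e^i(t)\in\Omega^1(\Sigma,\mathfrak{so}(3))$ and $\tau^i(t),\rho^i(t)\in C^\infty(\Sigma,\mathfrak{so}(3))$ depend smoothly on $t$, with $e^i(t)$ a coframe at every point. Suppose that at every $t$ $$\epsilon_{ijk}e^j\wedge F^k=0,\qquad\epsilon_{ijk}De^j\wedge e^k=0\quad\text{on }\Sigma,$$ $$\imath_\partial^*\Big(F_i+\tfrac{2\alpha_1\alpha_2-\alpha_4\alpha_5}{4\alpha_2\alpha_3-\alpha_5^2}\epsilon_{ijk}e^j\wedge e^k\Big)=0,\quad\imath_\partial^*\Big(De_i+\tfrac{2\alpha_3\alpha_4-\alpha_1\alpha_5}{4\alpha_2\alpha_3-\alpha_5^2}\epsilon_{ijk}e^j\wedge e^k\Big)=0,\quad\imath_\partial^*\big(\epsilon_{ijk}\rho^ie^j\wedge e^k\big)=0,$$ and that $$\dot A^i=D\tau^i+V_A^i,\qquad\dot e^i=D\rho^i-\epsilon^i{}_{jk}\tau^je^k+V_e^i,$$ where $V_A^i,V_e^i\in\Omega^1(\Sigma,\mathfrak{so}(3))$ are the unique solutions of $\epsilon_{ijk}e^j\wedge V_A^k=\epsilon_{ijk}\rho^jF^k$ and $\epsilon_{ijk}e^j\wedge V_e^k=\epsilon_{ijk}\rho^jDe^k$.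 Let $\bm\rho$ be the (time-dependent) vector field on $\Sigma$ defined by $\imath_{\bm\rho}e^i=\rho^i$. Then: (1) $\bm\rho$ is tangent to $\partial\Sigma$ at the points of $\partial\Sigma$, $V_A^i=\imath_{\bm\rho}F^i$ and $V_e^i=\imath_{\bm\rho}De^i$, and the evolution is a combination of diffeomorphisms and internal rotations: $$\dot A^i=\pounds_{\bm\rho}A^i+D(\tau^i-\imath_{\bm\rho}A^i),\qquad\dot e^i=\pounds_{\bm\rho}e^i-\epsilon^i{}_{jk}(\tau^j-\imath_{\bm\rho}A^j)e^k .$$ (2) The pullbacks to $\partial\Sigma$, denoted with a subindex $\partial$, satisfy $$\dot A_\partial^i=D_\partial\tau_\partial^i-2\tfrac{2\alpha_1\alpha_2-\alpha_4\alpha_5}{4\alpha_2\alpha_3-\alpha_5^2}\epsilon^i{}_{jk}\rho_\partial^je_\partial^k,$$ $$\dot e_\partial^i=D_\partial\rho_\partial^i-\epsilon^i{}_{jk}\tau_\partial^je_\partial^k-2\tfrac{2\alpha_3\alpha_4-\alpha_1\alpha_5}{4\alpha_2\alpha_3-\alpha_5^2}\epsilon^i{}_{jk}\rho_\partial^je_\partial^k .$$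
   Context: Indices $i,j,k\in\{1,2,3\}$ are $\mathfrak{so}(3)\cong\mathbb{R}^3$ indices, raised and lowered with $\delta_{ij}$; $\epsilon_{ijk}$ is the Levi-Civita symbol; repeated indices are summed; all fields are smooth. $F^i=\mathrm{d}A^i+\frac12\epsilon^i{}_{jk}A^j\wedge A^k$, and $D\phi^i=\mathrm{d}\phi^i+\epsilon^i{}_{jk}A^j\wedge\phi^k$ for $\mathfrak{so}(3)$-valued forms $\phi^i$; $D_\partial$ is the same operation on $\partial\Sigma$ with $A_\partial=\imath_\partial^*A$. A dot is $\partial/\partial t$, $\imath_{\bm\rho}$ is the interior product and $\pounds_{\bm\rho}$ the Lie derivative, acting on each component of an $\mathfrak{so}(3)$-valued form. These are the equations for integral curves of the Hamiltonian vector field (with $\tau^i=A_\perp^i$, $\rho^i=e_\perp^i$ the transverse components of the 4-dimensional fields) of the action $\int_{\mathbb{R}\times\Sigma}(\alpha_1\epsilon_{ijk}e^i\wedge e^j\wedge F^k+\alpha_2De_i\wedge De^i+\alpha_3F_i\wedge F^i+\alpha_4\epsilon_{ijk}De^i\wedge e^j\wedge e^k+\alpha_5F_i\wedge De^i)$, on the sector of its constraint submanifold defined by $\imath_\partial^*(\epsilon_{ijk}e_\perp^ie^j\wedge e^k)=0$. *)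

theory Defs
  imports "HOL-Analysis.Analysis"
begin

section \<open>Smooth maps on subsets of Euclidean spaces\<close>

primrec Ck_on :: "nat \<Rightarrow> 'a::real_normed_vector set \<Rightarrow> ('a \<Rightarrow> 'b::real_normed_vector) \<Rightarrow> bool" where
  "Ck_on 0 U f \<longleftrightarrow> continuous_on U f"
| "Ck_on (Suc k) U f \<longleftrightarrow>
     (\<forall>x\<in>U. f differentiable (at x)) \<and> (\<forall>v. Ck_on k U (\<lambda>x. frechet_derivative f (at x) v))"

text \<open>On a set that need not be open (relatively open subsets of a half-space), smooth means: locally
  the restriction of a smooth map on an open set.\<close>

definition smooth_on :: "'a::real_normed_vector set \<Rightarrow> ('a \<Rightarrow> 'b::real_normed_vector) \<Rightarrow> bool" where
  "smooth_on S f \<longleftrightarrow>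
     (\<forall>x\<in>S. \<exists>U g. open U \<and> x \<in> U \<and> (\<forall>k. Ck_on k U g) \<and> (\<forall>y\<in>S \<inter> U. f y = g y))"

section \<open>Manifolds\<close>

text \<open>An indexed atlas \<open>(U\<^sub>c, \<phi>\<^sub>c)\<close>; the index \<open>c\<close> ranges over a whole type, which is no restriction
  because \<open>U\<^sub>c\<close> may be empty.\<close>

record ('p, 'c, 'b) atlas =
  cdom :: "'c \<Rightarrow> 'p set"
  cmap :: "'c \<Rightarrow> 'p \<Rightarrow> 'b"

definition img :: "('p, 'c, 'b) atlas \<Rightarrow> 'c \<Rightarrow> 'b set" where
  "img M c = cmap M c ` cdom M c"

definition overlap :: "('p, 'c, 'b) atlas \<Rightarrow> 'c \<Rightarrow> 'c \<Rightarrow> 'b set" where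
  "overlap M c d = cmap M c ` (cdom M c \<inter> cdom M d)"

definition trans_map :: "('p, 'c, 'b) atlas \<Rightarrow> 'c \<Rightarrow> 'c \<Rightarrow> 'b \<Rightarrow> 'b" where
  "trans_map M c d = (\<lambda>x. cmap M d (inv_into (cdom M c) (cmap M c) x))"

definition trans_deriv ::
  "('p, 'c, 'b::real_normed_vector) atlas \<Rightarrow> 'c \<Rightarrow> 'c \<Rightarrow> 'b \<Rightarrow> 'b \<Rightarrow> 'b" where
  "trans_deriv M c d x = frechet_derivative (trans_map M c d) (at x within overlap M c d)"

text \<open>\<open>H\<close> is the model space: the whole Euclidean space, or a half-space for manifolds with
  boundary.\<close>

definition smooth_manifold ::
  "'b::real_normed_vector set \<Rightarrow> 'p topology \<Rightarrow> ('p, 'c, 'b) atlas \<Rightarrow> bool" where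
  "smooth_manifold H X M \<longleftrightarrow>
     Hausdorff_space X \<and> second_countable X \<and> (\<Union>c. cdom M c) = topspace X \<and>
     (\<forall>c. openin X (cdom M c) \<and> openin (top_of_set H) (img M c) \<and>
          homeomorphic_map (subtopology X (cdom M c)) (top_of_set (img M c)) (cmap M c)) \<and>
     (\<forall>c d. smooth_on (overlap M c d) (trans_map M c d))"

definition oriented_atlas :: "('p, 'c, real^'n) atlas \<Rightarrow> bool" where
  "oriented_atlas M \<longleftrightarrow> (\<forall>c d. \<forall>x\<in>overlap M c d. det (matrix (trans_deriv M c d x)) > 0)"

definition half_space3 :: "(real^3) set" where
  "half_space3 = {x. 0 \<le> x $ 3}"

definition oriented_3manifold_with_boundary ::
  "'p topology \<Rightarrow> ('p, 'c, real^3) atlas \<Rightarrow> bool" where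
  "oriented_3manifold_with_boundary X M \<longleftrightarrow> smooth_manifold half_space3 X M \<and> oriented_atlas M"

text \<open>The boundary with its induced atlas. A point is a boundary point if it lies on the face
  \<open>x $ 3 = 0\<close> in one, equivalently (lemma \<open>boundary_invariant\<close>) every, chart around it.\<close>

definition face_incl :: "real^2 \<Rightarrow> real^3" where
  "face_incl y = vector [y $ 1, y $ 2, 0]"

definition bdry :: "('p, 'c, real^3) atlas \<Rightarrow> ('p, 'c, real^2) atlas" where
  "bdry M = \<lparr> cdom = (\<lambda>c. {p \<in> cdom M c. cmap M c p $ 3 = 0}),
              cmap = (\<lambda>c p. vector [cmap M c p $ 1, cmap M c p $ 2]) \<rparr>"

section \<open>Differential forms and vector fields\<close>

text \<open>A tensor field is given by its representatives in the charts of the atlas. The representative of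
  a \<open>k\<close>-form in chart \<open>c\<close> at the coordinate point \<open>x\<close> is a function of lists of \<open>k\<close> tangent vectors; a
  function \<open>f\<close> is a 0-form, with value \<open>f c x []\<close>. Representatives are only meaningful for
  \<open>x \<in> img M c\<close> and lists of length \<open>k\<close>, so identities between forms are stated with \<open>holds_on\<close>.\<close>

type_synonym ('c, 'b) form = "'c \<Rightarrow> 'b \<Rightarrow> 'b list \<Rightarrow> real"
type_synonym ('c, 'b) so3_form = "3 \<Rightarrow> ('c, 'b) form"
type_synonym ('c, 'b) vfield = "'c \<Rightarrow> 'b \<Rightarrow> 'b"

definition holds_on :: "('p, 'c, 'b) atlas \<Rightarrow> nat \<Rightarrow> ('c \<Rightarrow> 'b \<Rightarrow> 'b list \<Rightarrow> bool) \<Rightarrow> bool" where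
  "holds_on M k P \<longleftrightarrow> (\<forall>c. \<forall>x\<in>img M c. \<forall>v. length v = k \<longrightarrow> P c x v)"

definition alternating_multilinear :: "nat \<Rightarrow> ('b::real_vector list \<Rightarrow> real) \<Rightarrow> bool" where
  "alternating_multilinear k w \<longleftrightarrow>
     (\<forall>v. length v = k \<longrightarrow>
        (\<forall>i<k. linear (\<lambda>u. w (v[i := u]))) \<and>
        (\<forall>i<k. \<forall>j<k. i \<noteq> j \<and> v ! i = v ! j \<longrightarrow> w v = 0))"

definition form_compatible :: "('p, 'c, 'b::real_normed_vector) atlas \<Rightarrow> nat \<Rightarrow> ('c, 'b) form \<Rightarrow> bool" where
  "form_compatible M k w \<longleftrightarrow>
     (\<forall>c d. \<forall>x\<in>overlap M c d. \<forall>v. length v = k \<longrightarrow>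
        w c x v = w d (trans_map M c d x) (map (trans_deriv M c d x) v))"

definition is_form :: "('p, 'c, 'b::real_normed_vector) atlas \<Rightarrow> nat \<Rightarrow> ('c, 'b) form \<Rightarrow> bool" where
  "is_form M k w \<longleftrightarrow>
     (\<forall>c. \<forall>x\<in>img M c. alternating_multilinear k (w c x)) \<and>
     form_compatible M k w \<and>
     (\<forall>c v. length v = k \<longrightarrow> smooth_on (img M c) (\<lambda>x. w c x v))"

definition is_tdep_form ::
  "real set \<Rightarrow> ('p, 'c, 'b::real_normed_vector) atlas \<Rightarrow> nat \<Rightarrow> (real \<Rightarrow> ('c, 'b) form) \<Rightarrow> bool" where
  "is_tdep_form I M k w \<longleftrightarrow>
     (\<forall>t\<in>I. is_form M k (w t)) \<and>
     (\<forall>c v. length v = k \<longrightarrow> smooth_on (I \<times> img M c) (\<lambda>(t, x). w t c x v))"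

definition is_vfield :: "('p, 'c, 'b::real_normed_vector) atlas \<Rightarrow> ('c, 'b) vfield \<Rightarrow> bool" where
  "is_vfield M X \<longleftrightarrow>
     (\<forall>c d. \<forall>x\<in>overlap M c d. X d (trans_map M c d x) = trans_deriv M c d x (X c x)) \<and>
     (\<forall>c. smooth_on (img M c) (X c))"

definition is_tdep_vfield ::
  "real set \<Rightarrow> ('p, 'c, 'b::real_normed_vector) atlas \<Rightarrow> (real \<Rightarrow> ('c, 'b) vfield) \<Rightarrow> bool" where
  "is_tdep_vfield I M X \<longleftrightarrow>
     (\<forall>t\<in>I. is_vfield M (X t)) \<and> (\<forall>c. smooth_on (I \<times> img M c) (\<lambda>(t, x). X t c x))"

definition time_deriv :: "(real \<Rightarrow> ('c, 'b) so3_form) \<Rightarrow> real \<Rightarrow> ('c, 'b) so3_form" where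
  "time_deriv \<phi> t = (\<lambda>i c x v. deriv (\<lambda>s. \<phi> s i c x v) t)"

text \<open>Product of a \<open>p\<close>-form and a \<open>q\<close>-form, normalised so that
  \<open>(\<alpha> \<and> \<beta>)(u, v) = \<alpha>(u) \<beta>(v) - \<alpha>(v) \<beta>(u)\<close> for 1-forms; for \<open>p = 0\<close> it is multiplication by a function.\<close>

definition wedge :: "nat \<Rightarrow> nat \<Rightarrow> ('c, 'b) form \<Rightarrow> ('c, 'b) form \<Rightarrow> ('c, 'b) form" where
  "wedge p q w z = (\<lambda>c x v.
     (\<Sum>\<sigma> | \<sigma> permutes {..<p + q}.
        of_int (sign \<sigma>) * w c x (map (\<lambda>i. v ! \<sigma> i) [0..<p]) * z c x (map (\<lambda>i. v ! \<sigma> i) [p..<p + q]))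
     / (fact p * fact q))"

definition ext_d :: "('p, 'c, 'b::real_normed_vector) atlas \<Rightarrow> ('c, 'b) form \<Rightarrow> ('c, 'b) form" where
  "ext_d M w = (\<lambda>c x v.
     \<Sum>i<length v. (-1) ^ i *
        frechet_derivative (\<lambda>y. w c y (take i v @ drop (Suc i) v)) (at x within img M c) (v ! i))"

definition int_prod :: "('c, 'b) vfield \<Rightarrow> ('c, 'b) form \<Rightarrow> ('c, 'b) form" where
  "int_prod X w = (\<lambda>c x v. w c x (X c x # v))"

text \<open>The coordinate expression
  \<open>(\<pounds>\<^sub>X w)\<^sub>a\<^sub>b\<^sub>\<dots> = X\<^sup>m \<partial>\<^sub>m w\<^sub>a\<^sub>b\<^sub>\<dots> + w\<^sub>m\<^sub>b\<^sub>\<dots> \<partial>\<^sub>a X\<^sup>m + w\<^sub>a\<^sub>m\<^sub>\<dots> \<partial>\<^sub>b X\<^sup>m + \<dots>\<close>.\<close>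

definition lie_deriv ::
  "('p, 'c, 'b::real_normed_vector) atlas \<Rightarrow> ('c, 'b) vfield \<Rightarrow> ('c, 'b) form \<Rightarrow> ('c, 'b) form" where
  "lie_deriv M X w = (\<lambda>c x v.
     frechet_derivative (\<lambda>y. w c y v) (at x within img M c) (X c x) +
     (\<Sum>i<length v. w c x (v[i := frechet_derivative (X c) (at x within img M c) (v ! i)])))"

definition bpull :: "('c, real^3) form \<Rightarrow> ('c, real^2) form" where
  "bpull w = (\<lambda>c y v. w c (face_incl y) (map face_incl v))"

definition bpull_so3 :: "('c, real^3) so3_form \<Rightarrow> ('c, real^2) so3_form" where
  "bpull_so3 \<phi> = (\<lambda>i. bpull (\<phi> i))"

definition tangent_to_bdry :: "('p, 'c, real^3) atlas \<Rightarrow> ('c, real^3) vfield \<Rightarrow> bool" where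
  "tangent_to_bdry M X \<longleftrightarrow>
     (\<forall>c. \<forall>y\<in>img (bdry M) c. X c (face_incl y) \<in> range face_incl)"

section \<open>Forms with values in so(3)\<close>

definition eps :: "3 \<Rightarrow> 3 \<Rightarrow> 3 \<Rightarrow> real" where
  "eps i j k =
     (if (i, j, k) \<in> {(1, 2, 3), (2, 3, 1), (3, 1, 2)} then 1
      else if (i, j, k) \<in> {(1, 3, 2), (2, 1, 3), (3, 2, 1)} then -1 else 0)"

text \<open>\<open>\<epsilon>\<^sup>i\<^sub>j\<^sub>k \<phi>\<^sup>j \<and> \<psi>\<^sup>k\<close> for a \<open>p\<close>-form \<open>\<phi>\<close> and a \<open>q\<close>-form \<open>\<psi>\<close>.\<close>

definition eps_wedge ::
  "nat \<Rightarrow> nat \<Rightarrow> ('c, 'b) so3_form \<Rightarrow> ('c, 'b) so3_form \<Rightarrow> ('c, 'b) so3_form" where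
  "eps_wedge p q \<phi> \<psi> = (\<lambda>i c x v. \<Sum>j\<in>UNIV. \<Sum>k\<in>UNIV. eps i j k * wedge p q (\<phi> j) (\<psi> k) c x v)"

definition curvature ::
  "('p, 'c, 'b::real_normed_vector) atlas \<Rightarrow> ('c, 'b) so3_form \<Rightarrow> ('c, 'b) so3_form" where
  "curvature M A = (\<lambda>i c x v. ext_d M (A i) c x v + 1 / 2 * eps_wedge 1 1 A A i c x v)"

definition cov_d ::
  "('p, 'c, 'b::real_normed_vector) atlas \<Rightarrow> ('c, 'b) so3_form \<Rightarrow> nat \<Rightarrow> ('c, 'b) so3_form
     \<Rightarrow> ('c, 'b) so3_form" where
  "cov_d M A p \<phi> = (\<lambda>i c x v. ext_d M (\<phi> i) c x v + eps_wedge 1 p A \<phi> i c x v)"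

text \<open>The covectors \<open>e\<^sup>1, e\<^sup>2, e\<^sup>3\<close> form a basis of the cotangent space at every point.\<close>

definition is_coframe :: "('p, 'c, 'b::real_vector) atlas \<Rightarrow> ('c, 'b) so3_form \<Rightarrow> bool" where
  "is_coframe M e \<longleftrightarrow>
     (\<forall>c. \<forall>x\<in>img M c. \<forall>l::'b \<Rightarrow> real. linear l \<longrightarrow>
        (\<exists>!a::3 \<Rightarrow> real. \<forall>u. l u = (\<Sum>i\<in>UNIV. a i * e i c x [u])))"

text \<open>\<open>V\<close> is a 1-form with \<open>\<epsilon>\<^sub>i\<^sub>j\<^sub>k e\<^sup>j \<and> V\<^sup>k = \<epsilon>\<^sub>i\<^sub>j\<^sub>k \<rho>\<^sup>j G\<^sup>k\<close>, for a function \<open>\<rho>\<close> and a 2-form \<open>G\<close>.\<close>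

definition solves_coframe_eq ::
  "('p, 'c, 'b::real_normed_vector) atlas \<Rightarrow> ('c, 'b) so3_form \<Rightarrow> ('c, 'b) so3_form
     \<Rightarrow> ('c, 'b) so3_form \<Rightarrow> ('c, 'b) so3_form \<Rightarrow> bool" where
  "solves_coframe_eq M e \<rho> G V \<longleftrightarrow>
     (\<forall>i. is_form M 1 (V i)) \<and>
     (\<forall>i. holds_on M 2 (\<lambda>c x v. eps_wedge 1 1 e V i c x v = eps_wedge 0 2 \<rho> G i c x v))"

section \<open>Invariance of the boundary\<close>

lemma boundary_invariant_aux:
  assumes M: "smooth_manifold half_space3 X M"
    and p: "p \<in> cdom M c" "p \<in> cdom M d" and pos: "cmap M c p $ 3 > 0"
  shows "cmap M d p $ 3 > 0"
proof -
  let ?H = "half_space3"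
  have hm: "homeomorphic_map (subtopology X (cdom M c)) (top_of_set (img M c)) (cmap M c)" for c
    using M by (auto simp: smooth_manifold_def)
  have op: "openin X (cdom M c)" "openin (top_of_set ?H) (img M c)" for c
    using M by (auto simp: smooth_manifold_def)
  have ts: "topspace (subtopology X (cdom M c)) = cdom M c" for c
    using op(1)[of c] openin_subset by fastforce
  have inj: "inj_on (cmap M c) (cdom M c)" for c
    using homeomorphic_imp_injective_map[OF hm[of c]] ts by simp
  have "openin (subtopology X (cdom M c)) (cdom M c \<inter> cdom M d)"
    by (metis op(1) openin_subtopology_Int inf_commute)
  then have "openin (top_of_set (img M c)) (overlap M c d)"
    unfolding overlap_def
    using homeomorphic_imp_open_map[OF hm[of c]] by (auto simp: open_map_def)
  then have ov: "openin (top_of_set ?H) (overlap M c d)"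
    using op(2)[of c] openin_trans by blast
  then obtain T where T: "open T" "overlap M c d = ?H \<inter> T"
    by (auto simp: openin_open)
  define W where "W = overlap M c d \<inter> {x. x $ 3 > 0}"
  have W: "W = T \<inter> {x. x $ 3 > 0}"
    unfolding W_def T(2) half_space3_def by auto
  have "open W"
    unfolding W by (intro open_Int T open_halfspace_component_gt_cart)
  moreover have "continuous_on W (trans_map M c d)"
  proof -
    have "smooth_on (overlap M c d) (trans_map M c d)"
      using M by (auto simp: smooth_manifold_def)
    then have "continuous (at x within W) (trans_map M c d)" if x: "x \<in> W" for x
    proof -
      obtain U g where U: "open U" "x \<in> U" "\<forall>k. Ck_on k U g"
        "\<forall>y\<in>overlap M c d \<inter> U. trans_map M c d y = g y"
        using \<open>smooth_on _ _\<close> x unfolding smooth_on_def W_def by blast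
      have "continuous_on U g" using U(3)[rule_format, of 0] by simp
      then have "continuous_on (W \<inter> U) g" by (rule continuous_on_subset) auto
      then have "continuous_on (W \<inter> U) (trans_map M c d)"
        by (rule continuous_on_cong[THEN iffD1, rotated -1]) (use U(4) in \<open>auto simp: W_def\<close>)
      moreover have "open (W \<inter> U)" using \<open>open W\<close> U by auto
      ultimately show ?thesis
        using x U(2) by (metis IntI continuous_on_eq_continuous_at continuous_at_imp_continuous_at_within)
    qed
    then show ?thesis by (simp add: continuous_on_eq_continuous_within)
  qed
  moreover have "inj_on (trans_map M c d) W"
    unfolding inj_on_def W_def overlap_def trans_map_def
    using inj[of c] inj[of d] by (auto simp: inv_into_f_f inj_on_eq_iff)
  ultimately have "open (trans_map M c d ` W)"
    using invariance_of_domain by blast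
  moreover have "trans_map M c d ` W \<subseteq> ?H"
  proof -
    have "trans_map M c d ` W \<subseteq> img M d"
      unfolding W_def overlap_def trans_map_def img_def using inj[of c] by (auto simp: inv_into_f_f)
    then show ?thesis using op(2)[of d] openin_imp_subset by blast
  qed
  ultimately have "trans_map M c d ` W \<subseteq> interior ?H"
    by (simp add: interior_maximal)
  moreover have "interior ?H = {x. x $ 3 > 0}"
    using interior_halfspace_component_ge[of 0 "3::3"] by (simp add: half_space3_def)
  moreover have "cmap M d p \<in> trans_map M c d ` W"
  proof
    show "cmap M c p \<in> W" using p pos by (auto simp: W_def overlap_def)
    show "cmap M d p = trans_map M c d (cmap M c p)"
      using p inj[of c] by (simp add: trans_map_def inv_into_f_f)
  qed
  ultimately show ?thesis by auto
qed

lemma boundary_invariant: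
  assumes M: "smooth_manifold half_space3 X M"
    and p: "p \<in> cdom M c" "p \<in> cdom M d"
  shows "cmap M c p $ 3 = 0 \<longleftrightarrow> cmap M d p $ 3 = 0"
proof -
  have "cmap M c p $ 3 \<ge> 0" if "p \<in> cdom M c" for c
  proof -
    have "openin (top_of_set half_space3) (img M c)"
      using M by (simp add: smooth_manifold_def)
    then have "img M c \<subseteq> half_space3" by (rule openin_imp_subset)
    then show ?thesis using that by (auto simp: img_def half_space3_def)
  qed
  then show ?thesis
    using boundary_invariant_aux[OF M p] boundary_invariant_aux[OF M p(2) p(1)] p
    by (metis less_eq_real_def less_irrefl)
qed

end

theory Submission
  imports Defs
begin

text \<open>At each point the coframe is an invertible matrix, and on the dual frame the equation
  \<open>\<epsilon>\<^sub>i\<^sub>j\<^sub>k e\<^sup>j \<and> V\<^sup>k = 0\<close> becomes nine independent linear equations for the nine components of \<open>V\<close>; so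
  the coframe equations have at most one solution. Contracting the constraint
  \<open>\<epsilon>\<^sub>i\<^sub>j\<^sub>k e\<^sup>j \<and> G\<^sup>k = 0\<close> with \<open>\<rho>\<close>, for \<open>G = F\<close> and \<open>G = De\<close>, shows that the interior product of \<open>\<rho>\<close>
  with \<open>G\<close> is that solution, and Cartan's formula turns the evolution into Lie derivatives and internal
  rotations. On the boundary \<open>\<epsilon>\<^sub>i\<^sub>j\<^sub>k \<rho>\<^sup>i e\<^sup>j \<and> e\<^sup>k\<close> is \<open>2 det e\<close> times the normal component of \<open>\<rho>\<close>, so \<open>\<rho>\<close> is
  tangent there and the boundary constraints can be contracted with it.\<close>

section \<open>Closure properties of smooth maps\<close>

text \<open>On an open set the derivative at a point sees only nearby values, so agreement on
  \<open>U\<close> passes to all directional derivatives, and the induction continues with those as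
  the new pair.\<close>

lemma Ck_on_cong:
  assumes "open U" "\<And>x. x \<in> U \<Longrightarrow> f x = g x" "Ck_on k U f"
  shows "Ck_on k U g"
  using assms(2,3)
proof (induction k arbitrary: f g)
  case 0
  then show ?case using continuous_on_cong by fastforce
next
  case (Suc k)
  have df: "f differentiable (at x)" if "x \<in> U" for x using Suc.prems(2) that by simp
  have eq: "frechet_derivative f (at x) = frechet_derivative g (at x)" if "x \<in> U" for x
    using frechet_derivative_transform_within_open[OF df[OF that] \<open>open U\<close> that] Suc.prems(1) by blast
  have "g differentiable (at x)" if "x \<in> U" for x
    using df[OF that] has_derivative_transform_within_open[OF _ \<open>open U\<close> that] Suc.prems(1)
    unfolding differentiable_def by blast
  moreover have "Ck_on k U (\<lambda>x. frechet_derivative g (at x) v)" for v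
  proof (rule Suc.IH)
    show "Ck_on k U (\<lambda>x. frechet_derivative f (at x) v)" using Suc.prems(2) by simp
  qed (simp add: eq)
  ultimately show ?case by simp
qed

lemma Ck_on_Suc_imp_Ck_on: "Ck_on (Suc k) U f \<Longrightarrow> Ck_on k U f"
proof (induction k arbitrary: f)
  case 0
  then show ?case
    by (metis Ck_on.simps differentiable_at_imp_differentiable_on differentiable_imp_continuous_on)
next
  case (Suc k)
  then show ?case by (metis Ck_on.simps(2))
qed

lemma Ck_on_subset: "Ck_on k U f \<Longrightarrow> V \<subseteq> U \<Longrightarrow> Ck_on k V f"
  by (induction k arbitrary: f) (auto intro: continuous_on_subset)

lemma Ck_on_const: "Ck_on k U (\<lambda>x. a)"
  by (induction k arbitrary: a) auto

lemma Ck_on_add: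
  assumes "open U" "Ck_on k U f" "Ck_on k U g"
  shows "Ck_on k U (\<lambda>x. f x + g x)"
  using assms(2,3)
proof (induction k arbitrary: f g)
  case 0
  then show ?case by (simp add: continuous_on_add)
next
  case (Suc k)
  have d: "((\<lambda>x. f x + g x) has_derivative
      (\<lambda>v. frechet_derivative f (at x) v + frechet_derivative g (at x) v)) (at x)"
    if "x \<in> U" for x
    using Suc.prems that by (auto intro!: has_derivative_add simp: frechet_derivative_works)
  have "Ck_on k U (\<lambda>x. frechet_derivative f (at x) v + frechet_derivative g (at x) v)" for v
    using Suc.prems by (intro Suc.IH) auto
  then have "Ck_on k U (\<lambda>x. frechet_derivative (\<lambda>x. f x + g x) (at x) v)" for v
    by (rule Ck_on_cong[OF \<open>open U\<close>, rotated]) (simp add: frechet_derivative_at[OF d, symmetric])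
  then show ?case using d by (auto simp: differentiable_def)
qed

text \<open>The Leibniz rule gives two products, each of a first derivative and an undifferentiated
  factor. The latter is lowered by one order with \<open>Ck_on_Suc_imp_Ck_on\<close> to meet the
  induction hypothesis.\<close>

lemma Ck_on_scaleR:
  fixes f :: "'a::real_normed_vector \<Rightarrow> real" and g :: "'a \<Rightarrow> 'b::real_normed_vector"
  assumes "open U" "Ck_on k U f" "Ck_on k U g"
  shows "Ck_on k U (\<lambda>x. f x *\<^sub>R g x)"
  using assms(2,3)
proof (induction k arbitrary: f g)
  case 0
  then show ?case by (simp add: continuous_on_scaleR)
next
  case (Suc k)
  have d: "((\<lambda>x. f x *\<^sub>R g x) has_derivative
      (\<lambda>v. f x *\<^sub>R frechet_derivative g (at x) v + frechet_derivative f (at x) v *\<^sub>R g x)) (at x)"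
    if "x \<in> U" for x
    using Suc.prems that by (auto intro!: has_derivative_scaleR simp: frechet_derivative_works)
  have "Ck_on k U (\<lambda>x. f x *\<^sub>R frechet_derivative g (at x) v + frechet_derivative f (at x) v *\<^sub>R g x)" for v
    using Suc.prems Suc.prems[THEN Ck_on_Suc_imp_Ck_on]
    by (intro Ck_on_add[OF \<open>open U\<close>] Suc.IH) auto
  then have "Ck_on k U (\<lambda>x. frechet_derivative (\<lambda>x. f x *\<^sub>R g x) (at x) v)" for v
    by (rule Ck_on_cong[OF \<open>open U\<close>, rotated]) (simp add: frechet_derivative_at[OF d, symmetric])
  then show ?case using d by (auto simp: differentiable_def)
qed

lemma Ck_on_inverse:
  fixes f :: "'a::real_normed_vector \<Rightarrow> real"
  assumes "open U" "\<And>x. x \<in> U \<Longrightarrow> f x \<noteq> 0" "Ck_on k U f"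
  shows "Ck_on k U (\<lambda>x. inverse (f x))"
  using assms(3)
proof (induction k)
  case 0
  then show ?case using assms(2) by (simp add: continuous_on_inverse)
next
  case (Suc k)
  \<comment> \<open>The derivative contains only \<open>inverse (f x)\<close> itself, of order
    \<open>k\<close> by induction, and a first derivative of \<open>f\<close>. Writing it with
    scalar multiplications lets \<open>Ck_on_scaleR\<close> apply directly.\<close>
  have d: "((\<lambda>x. inverse (f x)) has_derivative
      (\<lambda>v. - 1 *\<^sub>R (inverse (f x) *\<^sub>R frechet_derivative f (at x) v *\<^sub>R inverse (f x)))) (at x)"
    if "x \<in> U" for x
  proof -
    have "(f has_derivative frechet_derivative f (at x)) (at x)"
      using Suc.prems that by (simp add: frechet_derivative_works)
    from Deriv.has_derivative_inverse[OF assms(2)[OF that] this] show ?thesis by (simp add: mult.assoc)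
  qed
  have inv: "Ck_on k U (\<lambda>x. inverse (f x))"
    using Suc.IH Suc.prems by (blast dest: Ck_on_Suc_imp_Ck_on)
  have "Ck_on k U (\<lambda>x. - 1 *\<^sub>R (inverse (f x) *\<^sub>R frechet_derivative f (at x) v *\<^sub>R inverse (f x)))" for v
    using Suc.prems by (intro Ck_on_scaleR[OF \<open>open U\<close>] inv Ck_on_const) auto
  then have "Ck_on k U (\<lambda>x. frechet_derivative (\<lambda>x. inverse (f x)) (at x) v)" for v
    by (rule Ck_on_cong[OF \<open>open U\<close>, rotated]) (simp only: frechet_derivative_at[OF d, symmetric])
  then show ?case using d by (auto simp: differentiable_def)
qed

section \<open>Smoothness on sets that need not be open, through local extensions\<close>

lemma smooth_onE:
  assumes "smooth_on S f" "x \<in> S"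
  obtains U g where "open U" "x \<in> U" "\<And>k. Ck_on k U g" "\<And>y. y \<in> S \<Longrightarrow> y \<in> U \<Longrightarrow> f y = g y"
proof -
  obtain U g where "open U \<and> x \<in> U \<and> (\<forall>k. Ck_on k U g) \<and> (\<forall>y\<in>S \<inter> U. f y = g y)"
    using assms unfolding smooth_on_def by meson
  then show ?thesis by (intro that[of U g]) simp_all
qed

lemma smooth_on_cong: "(\<And>x. x \<in> S \<Longrightarrow> f x = g x) \<Longrightarrow> smooth_on S f \<Longrightarrow> smooth_on S g"
  unfolding smooth_on_def by fastforce

lemma smooth_on_const: "smooth_on S (\<lambda>x. a)"
  unfolding smooth_on_def by (intro ballI exI[of _ UNIV] exI[of _ "\<lambda>x. a"]) (simp add: Ck_on_const)

lemma smooth_on_add: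
  assumes "smooth_on S f" "smooth_on S g"
  shows "smooth_on S (\<lambda>x. f x + g x)"
  unfolding smooth_on_def
proof
  fix x assume x: "x \<in> S"
  obtain U f' where U: "open U" "x \<in> U" "\<And>k. Ck_on k U f'" "\<And>y. y \<in> S \<Longrightarrow> y \<in> U \<Longrightarrow> f y = f' y"
    using smooth_onE[OF assms(1) x] by blast
  obtain V g' where V: "open V" "x \<in> V" "\<And>k. Ck_on k V g'" "\<And>y. y \<in> S \<Longrightarrow> y \<in> V \<Longrightarrow> g y = g' y"
    using smooth_onE[OF assms(2) x] by blast
  show "\<exists>W h. open W \<and> x \<in> W \<and> (\<forall>k. Ck_on k W h) \<and> (\<forall>y\<in>S \<inter> W. f y + g y = h y)"
  proof (intro exI conjI allI ballI)
    show "open (U \<inter> V)" "x \<in> U \<inter> V" using U V by auto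
    show "Ck_on k (U \<inter> V) (\<lambda>y. f' y + g' y)" for k
      using U V Ck_on_subset[of k U f' "U \<inter> V"] Ck_on_subset[of k V g' "U \<inter> V"]
      by (simp add: Ck_on_add open_Int)
    show "f y + g y = f' y + g' y" if "y \<in> S \<inter> (U \<inter> V)" for y
      using U V that by simp
  qed
qed

lemma smooth_on_scaleR:
  fixes f :: "'a::real_normed_vector \<Rightarrow> real" and g :: "'a \<Rightarrow> 'b::real_normed_vector"
  assumes "smooth_on S f" "smooth_on S g"
  shows "smooth_on S (\<lambda>x. f x *\<^sub>R g x)"
  unfolding smooth_on_def
proof
  fix x assume x: "x \<in> S"
  obtain U f' where U: "open U" "x \<in> U" "\<And>k. Ck_on k U f'" "\<And>y. y \<in> S \<Longrightarrow> y \<in> U \<Longrightarrow> f y = f' y"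
    using smooth_onE[OF assms(1) x] by blast
  obtain V g' where V: "open V" "x \<in> V" "\<And>k. Ck_on k V g'" "\<And>y. y \<in> S \<Longrightarrow> y \<in> V \<Longrightarrow> g y = g' y"
    using smooth_onE[OF assms(2) x] by blast
  show "\<exists>W h. open W \<and> x \<in> W \<and> (\<forall>k. Ck_on k W h) \<and> (\<forall>y\<in>S \<inter> W. f y *\<^sub>R g y = h y)"
  proof (intro exI conjI allI ballI)
    show "open (U \<inter> V)" "x \<in> U \<inter> V" using U V by auto
    show "Ck_on k (U \<inter> V) (\<lambda>y. f' y *\<^sub>R g' y)" for k
      using U V Ck_on_subset[of k U f' "U \<inter> V"] Ck_on_subset[of k V g' "U \<inter> V"]
      by (simp add: Ck_on_scaleR open_Int)
    show "f y *\<^sub>R g y = f' y *\<^sub>R g' y" if "y \<in> S \<inter> (U \<inter> V)" for y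
      using U V that by simp
  qed
qed

lemma smooth_on_mult:
  fixes f g :: "'a::real_normed_vector \<Rightarrow> real"
  shows "smooth_on S f \<Longrightarrow> smooth_on S g \<Longrightarrow> smooth_on S (\<lambda>x. f x * g x)"
  using smooth_on_scaleR[of S f g] by simp

lemma smooth_on_inverse:
  fixes f :: "'a::real_normed_vector \<Rightarrow> real"
  assumes "smooth_on S f" "\<And>x. x \<in> S \<Longrightarrow> f x \<noteq> 0"
  shows "smooth_on S (\<lambda>x. inverse (f x))"
  unfolding smooth_on_def
proof
  fix x assume x: "x \<in> S"
  obtain U g where U: "open U" "x \<in> U" "\<And>k. Ck_on k U g" "\<And>y. y \<in> S \<Longrightarrow> y \<in> U \<Longrightarrow> f y = g y"
    using smooth_onE[OF assms(1) x] by blast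
  \<comment> \<open>The local extension \<open>g\<close> may vanish off \<open>S\<close> although
    \<open>f\<close> does not vanish on \<open>S\<close>, so its zeros are removed; \<open>V\<close>
    stays open because \<open>g\<close> is continuous.\<close>
  define V where "V = U \<inter> g -` (- {0})"
  have "open V"
    unfolding V_def using U(3)[of 0] \<open>open U\<close> by (auto intro!: continuous_open_preimage)
  moreover have "x \<in> V" using assms(2)[OF x] U(2) U(4)[OF x] by (simp add: V_def)
  moreover have "Ck_on k V (\<lambda>y. inverse (g y))" for k
    by (rule Ck_on_inverse[OF \<open>open V\<close>]) (use U(3) Ck_on_subset[of k U g V] in \<open>auto simp: V_def\<close>)
  ultimately show "\<exists>W h. open W \<and> x \<in> W \<and> (\<forall>k. Ck_on k W h) \<and> (\<forall>y\<in>S \<inter> W. inverse (f y) = h y)"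
  proof (intro exI conjI allI ballI)
    show "inverse (f y) = inverse (g y)" if "y \<in> S \<inter> V" for y
      using U(4) that by (simp add: V_def)
  qed
qed

lemma smooth_on_sum: "(\<And>i. i \<in> J \<Longrightarrow> smooth_on S (f i)) \<Longrightarrow> smooth_on S (\<lambda>x. \<Sum>i\<in>J. f i x)"
  by (induction J rule: infinite_finite_induct) (auto intro!: smooth_on_add smooth_on_const)

lemma smooth_on_prod:
  fixes f :: "'i \<Rightarrow> 'a::real_normed_vector \<Rightarrow> real"
  shows "(\<And>i. i \<in> J \<Longrightarrow> smooth_on S (f i)) \<Longrightarrow> smooth_on S (\<lambda>x. \<Prod>i\<in>J. f i x)"
  by (induction J rule: infinite_finite_induct) (auto intro!: smooth_on_mult smooth_on_const)

lemma smooth_on_det: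
  fixes E :: "'a::real_normed_vector \<Rightarrow> real^'n^'n"
  assumes "\<And>i j. smooth_on S (\<lambda>x. E x $ i $ j)"
  shows "smooth_on S (\<lambda>x. det (E x))"
  unfolding det_def by (intro smooth_on_sum smooth_on_mult smooth_on_prod smooth_on_const assms)

text \<open>Cramer's rule expresses the solution by determinants of smooth entries over a
  nonvanishing determinant. Thus a pointwise solution of a linear system is automatically smooth;
  this is how the vector field dual to \<rho> acquires its regularity.\<close>

lemma smooth_on_linear_solution:
  fixes E :: "'a::real_normed_vector \<Rightarrow> real^'n^'n" and b r :: "'a \<Rightarrow> real^'n"
  assumes E: "\<And>i j. smooth_on S (\<lambda>x. E x $ i $ j)" and b: "\<And>i. smooth_on S (\<lambda>x. b x $ i)"
    and det: "\<And>x. x \<in> S \<Longrightarrow> det (E x) \<noteq> 0" and r: "\<And>x. x \<in> S \<Longrightarrow> E x *v r x = b x"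
  shows "smooth_on S r"
proof (rule smooth_on_cong)
  let ?D = "\<lambda>k x. det (\<chi> i j. if j = k then b x $ i else E x $ i $ j)"
  have entry: "smooth_on S (\<lambda>x. (\<chi> i j. if j = k then b x $ i else E x $ i $ j) $ i $ j)" for i j k
    using E b by (cases "j = k") auto
  show "smooth_on S (\<lambda>x. \<Sum>k\<in>UNIV. (?D k x * inverse (det (E x))) *\<^sub>R axis k 1)"
    by (intro smooth_on_sum smooth_on_scaleR smooth_on_mult smooth_on_det smooth_on_inverse
        smooth_on_const entry E det)
  fix x assume x: "x \<in> S"
  have "r x = (\<chi> k. ?D k x / det (E x))"
    using r[OF x] cramer[OF det[OF x]] by blast
  then have "r x $ k = ?D k x * inverse (det (E x))" for k by (simp add: divide_inverse)
  then show "(\<Sum>k\<in>UNIV. (?D k x * inverse (det (E x))) *\<^sub>R axis k 1) = r x"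
    using basis_expansion[of "r x"] by (simp add: scalar_mult_eq_scaleR)
qed

lemma smooth_on_imp_differentiable:
  assumes "smooth_on S f" "x \<in> S"
  shows "f differentiable (at x within S)"
proof -
  obtain U g where U: "open U" "x \<in> U" "\<And>k. Ck_on k U g" "\<And>y. y \<in> S \<Longrightarrow> y \<in> U \<Longrightarrow> f y = g y"
    using smooth_onE[OF assms] by blast
  obtain d where d: "d > 0" "ball x d \<subseteq> U"
    using U(1,2) open_contains_ball by blast
  have "g differentiable (at x)" using U(2) U(3)[of 1] by simp
  then obtain g' where g': "(g has_derivative g') (at x within S)"
    by (auto simp: differentiable_def intro: has_derivative_at_withinI)
  have "(f has_derivative g') (at x within S)"
    by (rule has_derivative_transform_within[OF g' d(1) assms(2)])
      (use U(4) d(2) in \<open>auto simp: subset_eq dist_commute\<close>)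
  then show ?thesis by (auto simp: differentiable_def)
qed

section \<open>Wedge products and coframes at a point\<close>

lemma sum_permutes_lessThan_2:
  "(\<Sum>\<sigma> | \<sigma> permutes {..<Suc (Suc 0)}. f \<sigma>) = f id + f (Transposition.transpose 0 1)"
proof -
  have "{..<Suc (Suc 0)} = insert 0 {1}" by auto
  then show ?thesis
    using sum_over_permutations_insert[of "{1}" "0::nat" f] by (simp add: permutes_sing)
qed

text \<open>Each permutation of {0, 1, 2} factors as a transposition moving 0 (or the identity)
  composed with a permutation of {1, 2}, which is split in the same way.\<close>

lemma sum_permutes_lessThan_3:
  "(\<Sum>\<sigma> | \<sigma> permutes {..<Suc (Suc (Suc 0))}. f \<sigma>) =
     f id + f (Transposition.transpose 1 2) + f (Transposition.transpose 0 1)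
     + f (Transposition.transpose 0 1 \<circ> Transposition.transpose 1 2)
     + f (Transposition.transpose 0 2)
     + f (Transposition.transpose 0 2 \<circ> Transposition.transpose 1 2)"
proof -
  have 3: "{..<Suc (Suc (Suc 0))} = insert 0 {1, 2}" by auto
  have "(\<Sum>q | q permutes {1, 2::nat}. h q) = h id + h (Transposition.transpose 1 2)"
    for h :: "(nat \<Rightarrow> nat) \<Rightarrow> 'a"
    using sum_over_permutations_insert[of "{2}" "1::nat" h] by (simp add: permutes_sing)
  then show ?thesis
    unfolding 3 using sum_over_permutations_insert[of "{1, 2}" "0::nat" f] by (simp add: add_ac)
qed

lemma wedge_1_1:
  "wedge 1 1 w z c x [u, v] = w c x [u] * z c x [v] - w c x [v] * z c x [u]"
  by (simp add: wedge_def sum_permutes_lessThan_2 sign_swap_id sign_id)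

lemma wedge_0_1: "wedge 0 1 w z c x [u] = w c x [] * z c x [u]"
  by (simp add: wedge_def lessThan_Suc permutes_sing sign_id)

lemma wedge_1_0: "wedge 1 0 w z c x [u] = w c x [u] * z c x []"
  by (simp add: wedge_def lessThan_Suc permutes_sing sign_id)

text \<open>The definition antisymmetrises \<open>z\<close> and divides by 2!, so the plain product
  \<open>w z\<close> appears only once \<open>z\<close> is known to alternate.\<close>

lemma wedge_0_2: "wedge 0 2 w z c x [u, v] = w c x [] * (z c x [u, v] - z c x [v, u]) / 2"
  by (simp add: wedge_def sum_permutes_lessThan_2 sign_swap_id sign_id upt_rec algebra_simps)

lemma sign_transpose_comp_3:
  "sign (Transposition.transpose 0 (Suc 0) \<circ> Transposition.transpose (Suc 0) 2) = 1"
  "sign (Transposition.transpose 0 2 \<circ> Transposition.transpose (Suc 0) 2) = 1"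
  by (simp_all add: sign_compose permutation_swap_id sign_swap_id)

text \<open>The six permutations pair up under exchange of the two arguments of \<open>z\<close>.
  Antisymmetry makes the members of a pair equal, which cancels the factor 1/2.\<close>

lemma wedge_1_2:
  assumes "\<And>u v. z c x [v, u] = - z c x [u, v]"
  shows "wedge 1 2 w z c x [s, u, v] =
    w c x [s] * z c x [u, v] - w c x [u] * z c x [s, v] + w c x [v] * z c x [s, u]"
proof -
  have "wedge 1 2 w z c x [s, u, v] =
    (w c x [s] * z c x [u, v] - w c x [s] * z c x [v, u] - w c x [u] * z c x [s, v]
     + w c x [u] * z c x [v, s] - w c x [v] * z c x [u, s] + w c x [v] * z c x [s, u]) / 2"
    unfolding wedge_def
    by (simp add: sum_permutes_lessThan_3 sign_transpose_comp_3 sign_swap_id sign_id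
        upt_rec Transposition.transpose_def algebra_simps)
  then show ?thesis
    using assms[of v u] assms[of u s] assms[of v s] by (simp add: algebra_simps)
qed

lemma wedge_2_1:
  assumes "\<And>u v. w c x [v, u] = - w c x [u, v]"
  shows "wedge 2 1 w z c x [s, u, v] =
    z c x [s] * w c x [u, v] - z c x [u] * w c x [s, v] + z c x [v] * w c x [s, u]"
proof -
  have "wedge 2 1 w z c x [s, u, v] =
    (z c x [s] * w c x [u, v] - z c x [s] * w c x [v, u] - z c x [u] * w c x [s, v]
     + z c x [u] * w c x [v, s] - z c x [v] * w c x [u, s] + z c x [v] * w c x [s, u]) / 2"
    unfolding wedge_def
    by (simp add: sum_permutes_lessThan_3 sign_transpose_comp_3 sign_swap_id sign_id
        upt_rec Transposition.transpose_def algebra_simps)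
  then show ?thesis
    using assms[of v u] assms[of u s] assms[of v s] by (simp add: algebra_simps)
qed

lemma holds_on_0: "holds_on M 0 P \<longleftrightarrow> (\<forall>c. \<forall>x\<in>img M c. P c x [])"
  by (simp add: holds_on_def)

lemma holds_on_1: "holds_on M 1 P \<longleftrightarrow> (\<forall>c. \<forall>x\<in>img M c. \<forall>u. P c x [u])"
  by (auto simp: holds_on_def length_Suc_conv)

lemma holds_on_2: "holds_on M 2 P \<longleftrightarrow> (\<forall>c. \<forall>x\<in>img M c. \<forall>u v. P c x [u, v])"
  by (auto simp: holds_on_def length_Suc_conv numeral_2_eq_2)

lemma holds_on_3: "holds_on M 3 P \<longleftrightarrow> (\<forall>c. \<forall>x\<in>img M c. \<forall>s u v. P c x [s, u, v])"
  by (auto simp: holds_on_def length_Suc_conv numeral_3_eq_3)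

text \<open>Expanding the coordinate functionals in the coframe recovers \<open>u\<close> from
  \<open>E *v u\<close>, so \<open>E\<close> is injective and hence invertible.\<close>

lemma is_coframeD:
  assumes "is_coframe M (e :: ('c, real^3) so3_form)" "x \<in> img M c"
    and E: "\<And>i u. e i c x [u] = (E *v u) $ i"
  shows "det E \<noteq> 0"
proof -
  have "\<exists>a. \<forall>u::real^3. u $ m = (\<Sum>i\<in>UNIV. a i * (E *v u) $ i)" for m
  proof -
    have "linear (\<lambda>u::real^3. u $ m)" by (simp add: linear_iff)
    then have "\<exists>!a. \<forall>u. u $ m = (\<Sum>i\<in>UNIV. a i * e i c x [u])"
      using assms(1,2) unfolding is_coframe_def by blast
    then show ?thesis unfolding E by (rule ex1_implies_ex)
  qed
  then obtain a where a: "\<And>m (u::real^3). u $ m = (\<Sum>i\<in>UNIV. a m i * (E *v u) $ i)" by metis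
  have "inj ((*v) E)"
  proof (rule injI)
    fix u v assume "E *v u = E *v v"
    then have "u $ m = v $ m" for m using a[of u m] a[of v m] by simp
    then show "u = v" by (simp add: vec_eq_iff)
  qed
  then show ?thesis
    by (simp add: invertible_det_nz[symmetric] matrix_left_invertible_injective invertible_left_inverse)
qed

text \<open>On the dual frame the equation says \<open>\<epsilon>\<^sub>i\<^sub>a\<^sub>k D\<^sub>k\<^sub>b = \<epsilon>\<^sub>i\<^sub>b\<^sub>k D\<^sub>k\<^sub>a\<close>, nine scalar equations that force
  the nine components to vanish.\<close>

lemma coframe_wedge_cancel:
  fixes E :: "real^3^3" and D :: "3 \<Rightarrow> real^3 \<Rightarrow> real"
  assumes det: "det E \<noteq> 0" and lin: "\<And>k. linear (D k)"
    and eq: "\<And>i u v. (\<Sum>j\<in>UNIV. \<Sum>k\<in>UNIV. eps i j k * ((E *v u) $ j * D k v - (E *v v) $ j * D k u)) = 0"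
  shows "D k u = 0"
proof -
  obtain B where B: "E ** B = mat 1" "B ** E = mat 1"
    using det invertible_det_nz[of E] unfolding invertible_def by blast
  \<comment> \<open>The columns of the inverse matrix form the frame dual to the coframe.\<close>
  define f where "f a = B *v axis a 1" for a
  have dual: "(E *v f a) $ j = (if j = a then 1 else 0)" for a j
    by (simp add: f_def matrix_vector_mul_assoc B axis_def)
  have nine: "(\<Sum>j\<in>UNIV. \<Sum>k\<in>UNIV. eps i j k *
      ((if j = a then 1 else 0) * D k (f b) - (if j = b then 1 else 0) * D k (f a))) = 0" for i a b
    using eq[of i "f a" "f b"] by (simp only: dual)
  have zero: "D k (f a) = 0" for k a
    using nine[of 1 1 2] nine[of 1 1 3] nine[of 1 2 3] nine[of 2 1 2] nine[of 2 1 3] nine[of 2 2 3]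
      nine[of 3 1 2] nine[of 3 1 3] nine[of 3 2 3] exhaust_3[of k] exhaust_3[of a]
    by (auto simp: sum_3 eps_def)
  have "u = B *v (E *v u)" by (simp add: matrix_vector_mul_assoc B)
  also have "E *v u = (\<Sum>a\<in>UNIV. (E *v u) $ a *\<^sub>R axis a 1)"
    using basis_expansion[of "E *v u"] by (simp add: scalar_mult_eq_scaleR)
  finally have "u = (\<Sum>a\<in>UNIV. (E *v u) $ a *\<^sub>R f a)"
    by (simp add: f_def matrix_vector_mult_scaleR linear_sum[OF matrix_vector_mul_linear])
  then have "D k u = D k (\<Sum>a\<in>UNIV. (E *v u) $ a *\<^sub>R f a)" by simp
  also have "\<dots> = 0" by (simp add: linear_sum[OF lin] linear_cmul[OF lin] zero)
  finally show ?thesis .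
qed

text \<open>This is the triple product of three images under \<open>E\<close>, hence
  \<open>det E\<close> times the determinant with columns \<open>r\<close>, \<open>axis 1 1\<close>,
  \<open>axis 2 1\<close>, which equals \<open>r $ 3\<close>. It isolates the component of
  \<open>r\<close> normal to the face.\<close>

lemma eps_sum_det:
  fixes E :: "real^3^3"
  shows "(\<Sum>i\<in>UNIV. \<Sum>j\<in>UNIV. \<Sum>k\<in>UNIV. eps i j k * ((E *v r) $ i * (E *v axis 1 1) $ j * (E *v axis 2 1) $ k))
    = det E * r $ 3"
  by (simp add: matrix_vector_mult_basis det_3 sum_3 eps_def matrix_vector_mult_def axis_def
      column_def algebra_simps)

section \<open>Differentials of forms and their restriction to the boundary\<close>

text \<open>\<open>frechet_derivative\<close> is a choice, so it can be computed only where
  derivatives within the set are unique. At a face point steps in one direction suffice: moving by a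
  positive multiple of a basis vector never leaves the half-space.\<close>

lemma frechet_derivative_half_space:
  fixes f :: "real^3 \<Rightarrow> real"
  assumes S: "openin (top_of_set half_space3) S" "x \<in> S"
    and f: "(f has_derivative f') (at x within S)"
  shows "frechet_derivative f (at x within S) = f'"
proof (rule frechet_derivative_unique_within[OF _ f])
  show "(f has_derivative frechet_derivative f (at x within S)) (at x within S)"
    using f frechet_derivative_works differentiable_def by blast
  fix i :: "real^3" and e :: real
  assume i: "i \<in> Basis" and e: "e > 0"
  obtain T where T: "open T" "S = half_space3 \<inter> T" using S(1) by (auto simp: openin_open)
  then obtain r where r: "r > 0" "ball x r \<subseteq> T"
    using S(2) open_contains_ball by blast
  \<comment> \<open>Halving the minimum makes the step strictly smaller both than the prescribed
    bound \<open>e\<close> and than the radius of the ball inside \<open>T\<close>.\<close>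
  define d where "d = min e r / 2"
  have d: "0 < d" "d < e" "d < r" using e r by (auto simp: d_def)
  have "x + d *\<^sub>R i \<in> ball x r" using i d by (simp add: dist_norm)
  moreover have "i $ 3 \<ge> 0" using i by (auto simp: Basis_vec_def axis_def)
  then have "x + d *\<^sub>R i \<in> half_space3"
    using S(2) T(2) d by (simp add: half_space3_def)
  ultimately have "x + d *\<^sub>R i \<in> S" using T(2) r by blast
  then show "\<exists>d. 0 < \<bar>d\<bar> \<and> \<bar>d\<bar> < e \<and> x + d *\<^sub>R i \<in> S"
    using d by (intro exI[of _ d]) simp
qed

lemma has_derivative_within_cong:
  assumes "(f has_derivative f') (at x within S)" "x \<in> S" "\<And>y. y \<in> S \<Longrightarrow> f y = g y"
  shows "(g has_derivative f') (at x within S)"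
  by (rule has_derivative_transform_within[OF assms(1) zero_less_one assms(2)]) (use assms(3) in simp)

lemma is_form_1_linear:
  assumes "is_form M 1 w" "x \<in> img M c"
  shows "linear (\<lambda>u. w c x [u])"
proof -
  have "alternating_multilinear 1 (w c x)" using assms by (simp add: is_form_def)
  then show ?thesis
    \<comment> \<open>Any one-element list would do, since its only entry is overwritten by the slot
      update.\<close>
    unfolding alternating_multilinear_def by (auto dest!: spec[of _ "[0]"])
qed

lemma ext_d_oneform:
  "ext_d M w c x [u, v] = frechet_derivative (\<lambda>y. w c y [v]) (at x within img M c) u
     - frechet_derivative (\<lambda>y. w c y [u]) (at x within img M c) v"
  by (simp add: ext_d_def)

lemma oneform_coords:
  assumes "is_form (M :: ('p, 'c, real^3) atlas) 1 w" "y \<in> img M c"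
  shows "w c y [u] = (\<Sum>m\<in>UNIV. u $ m * w c y [axis m 1])"
proof -
  have lin: "linear (\<lambda>u. w c y [u])" by (rule is_form_1_linear[OF assms])
  have "w c y [u] = w c y [\<Sum>m\<in>UNIV. u $ m *\<^sub>R axis m 1]"
    using basis_expansion[of u] by (simp add: scalar_mult_eq_scaleR)
  also have "\<dots> = (\<Sum>m\<in>UNIV. u $ m * w c y [axis m 1])"
    using linear_sum[OF lin, of "\<lambda>m. u $ m *\<^sub>R axis m 1" UNIV]
    by (simp add: linear_cmul[OF lin])
  finally show ?thesis .
qed

section \<open>Derivatives of one-forms at a chart point that may lie on the face\<close>

context
  fixes M :: "('p, 'c, real^3) atlas" and c :: 'c and x :: "real^3"
  assumes op: "openin (top_of_set half_space3) (img M c)" and x: "x \<in> img M c"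
begin

lemma form_has_derivative:
  assumes "is_form M k w" "length v = k"
  shows "((\<lambda>y. w c y v) has_derivative frechet_derivative (\<lambda>y. w c y v) (at x within img M c)) (at x within img M c)"
  using assms x smooth_on_imp_differentiable[of "img M c" "\<lambda>y. w c y v" x]
  by (simp add: is_form_def frechet_derivative_works)

text \<open>The argument \<open>u\<close> is constant while the base point moves, so the coordinate
  expansion, which holds on the chart image, is differentiated term by term within that
  image.\<close>

lemma frechet_derivative_oneform:
  assumes "is_form M 1 w"
  shows "frechet_derivative (\<lambda>y. w c y [u]) (at x within img M c) h =
    (\<Sum>m\<in>UNIV. u $ m * frechet_derivative (\<lambda>y. w c y [axis m 1]) (at x within img M c) h)"
proof -
  have "((\<lambda>y. \<Sum>m\<in>UNIV. u $ m * w c y [axis m 1]) has_derivative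
      (\<lambda>h. \<Sum>m\<in>UNIV. u $ m * frechet_derivative (\<lambda>y. w c y [axis m 1]) (at x within img M c) h)) (at x within img M c)"
    by (intro has_derivative_sum has_derivative_mult_right form_has_derivative[OF assms]) simp
  then have "((\<lambda>y. w c y [u]) has_derivative
      (\<lambda>h. \<Sum>m\<in>UNIV. u $ m * frechet_derivative (\<lambda>y. w c y [axis m 1]) (at x within img M c) h)) (at x within img M c)"
    by (rule has_derivative_within_cong[OF _ x]) (rule oneform_coords[OF assms, symmetric])
  then show ?thesis by (simp only: frechet_derivative_half_space[OF op x])
qed

lemma linear_ext_d_oneform:
  assumes "is_form M 1 w"
  shows "linear (\<lambda>v. ext_d M w c x [u, v])"
proof -
  let ?w' = "\<lambda>m. frechet_derivative (\<lambda>y. w c y [axis m 1]) (at x within img M c) u"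
  have "linear (\<lambda>v. \<Sum>m\<in>UNIV. v $ m * ?w' m)"
    by (rule linearI) (simp_all add: sum.distrib sum_distrib_left algebra_simps)
  moreover have "(\<lambda>v. frechet_derivative (\<lambda>y. w c y [v]) (at x within img M c) u) = (\<lambda>v. \<Sum>m\<in>UNIV. v $ m * ?w' m)"
    by (rule ext) (rule frechet_derivative_oneform[OF assms])
  ultimately have "linear (\<lambda>v. frechet_derivative (\<lambda>y. w c y [v]) (at x within img M c) u)" by (simp only:)
  moreover have "linear (frechet_derivative (\<lambda>y. w c y [u]) (at x within img M c))"
    using form_has_derivative[OF assms, of "[u]"] has_derivative_linear by simp
  ultimately show ?thesis unfolding ext_d_oneform by (rule linear_compose_sub)
qed

text \<open>Both the form and its argument vary with the point. In coordinates the contraction is a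
  finite sum of products of scalar functions; the product rule is applied there and the two
  resulting sums are reassembled.\<close>

lemma has_derivative_int_prod:
  fixes r :: "('c, real^3) vfield"
  assumes w: "is_form M 1 w" and r: "smooth_on (img M c) (r c)"
  shows "((\<lambda>y. int_prod r w c y []) has_derivative
      (\<lambda>h. frechet_derivative (\<lambda>y. w c y [r c x]) (at x within img M c) h
         + w c x [frechet_derivative (r c) (at x within img M c) h])) (at x within img M c)"
proof -
  let ?r' = "frechet_derivative (r c) (at x within img M c)"
  let ?w' = "\<lambda>m. frechet_derivative (\<lambda>y. w c y [axis m 1]) (at x within img M c)"
  have "(r c has_derivative ?r') (at x within img M c)"
    using smooth_on_imp_differentiable[OF r x] by (simp add: frechet_derivative_works)
  then have r': "((\<lambda>y. r c y $ m) has_derivative (\<lambda>h. ?r' h $ m)) (at x within img M c)" for m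
    by (rule bounded_linear.has_derivative[OF bounded_linear_vec_nth])
  have "((\<lambda>y. \<Sum>m\<in>UNIV. r c y $ m * w c y [axis m 1]) has_derivative
      (\<lambda>h. \<Sum>m\<in>UNIV. r c x $ m * ?w' m h + ?r' h $ m * w c x [axis m 1])) (at x within img M c)"
    by (intro has_derivative_sum has_derivative_mult r' form_has_derivative[OF w]) simp
  then have "((\<lambda>y. int_prod r w c y []) has_derivative
      (\<lambda>h. \<Sum>m\<in>UNIV. r c x $ m * ?w' m h + ?r' h $ m * w c x [axis m 1])) (at x within img M c)"
    by (rule has_derivative_within_cong[OF _ x])
      (simp only: int_prod_def oneform_coords[OF w, where u = "r c _"])
  moreover have "(\<Sum>m\<in>UNIV. r c x $ m * ?w' m h + ?r' h $ m * w c x [axis m 1]) =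
      frechet_derivative (\<lambda>y. w c y [r c x]) (at x within img M c) h + w c x [?r' h]" for h
    by (simp only: sum.distrib frechet_derivative_oneform[OF w, of "r c x"]
        oneform_coords[OF w x, of "?r' h"])
  ultimately show ?thesis by (simp only:)
qed

end

section \<open>The inclusion of the face in charts\<close>

lemma face_incl_linear: "linear face_incl"
  by (rule linearI) (simp_all add: face_incl_def vec_eq_iff forall_3)

lemma img_bdry:
  "img (bdry M) c = {y. face_incl y \<in> img M c}"
proof (intro equalityI subsetI)
  fix y assume "y \<in> img (bdry M) c"
  then obtain p where "p \<in> cdom M c" "cmap M c p $ 3 = 0" "y = vector [cmap M c p $ 1, cmap M c p $ 2]"
    by (auto simp: img_def bdry_def)
  then show "y \<in> {y. face_incl y \<in> img M c}"
    by (auto simp: img_def face_incl_def vec_eq_iff forall_3 intro!: image_eqI[of _ _ p])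
next
  fix y assume "y \<in> {y. face_incl y \<in> img M c}"
  then obtain p where "p \<in> cdom M c" "face_incl y = cmap M c p" by (auto simp: img_def)
  then show "y \<in> img (bdry M) c"
    by (auto simp: img_def bdry_def face_incl_def vec_eq_iff forall_2 forall_3 intro!: image_eqI[of _ _ p])
qed

lemma range_face_incl: "range face_incl = {x. x $ 3 = 0}"
proof (intro equalityI subsetI)
  fix x :: "real^3" assume "x \<in> {x. x $ 3 = 0}"
  then have "x = face_incl (vector [x $ 1, x $ 2])" by (simp add: face_incl_def vec_eq_iff forall_3)
  then show "x \<in> range face_incl" by blast
qed (auto simp: face_incl_def)

text \<open>This is the chain rule for the linear map \<open>face_incl\<close>, in other words d
  commutes with restriction of functions to the boundary. A derivative within the chart image
  becomes an ordinary derivative on the boundary chart, whose image is open in the plane.\<close>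

lemma frechet_derivative_bdry:
  fixes f :: "real^3 \<Rightarrow> real"
  assumes op: "openin (top_of_set half_space3) (img M c)" and y: "y \<in> img (bdry M) c"
    and f: "f differentiable (at (face_incl y) within img M c)"
  shows "frechet_derivative (\<lambda>y. f (face_incl y)) (at y within img (bdry M) c) w
    = frechet_derivative f (at (face_incl y) within img M c) (face_incl w)"
proof -
  obtain T where T: "open T" "img M c = half_space3 \<inter> T" using op by (auto simp: openin_open)
  have bl: "bounded_linear face_incl" by (simp add: face_incl_linear linear_conv_bounded_linear[symmetric])
  \<comment> \<open>Points of the face satisfy the half-space condition automatically, so only the
    open set \<open>T\<close> restricts the preimage.\<close>
  have "img (bdry M) c = face_incl -` T"
    unfolding img_bdry T(2) by (auto simp: face_incl_def half_space3_def)
  moreover have "open (face_incl -` T)"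
    using T(1) bl continuous_open_vimage linear_continuous_at by blast
  ultimately have "open (img (bdry M) c)" by (simp only:)
  then have at: "at y within img (bdry M) c = at y" by (rule at_within_open[OF y])
  have 1: "(face_incl has_derivative face_incl) (at y within img (bdry M) c)"
    by (rule bounded_linear_imp_has_derivative[OF bl])
  have "face_incl ` img (bdry M) c \<subseteq> img M c" by (simp add: img_bdry image_subset_iff)
  then have 2: "(f has_derivative frechet_derivative f (at (face_incl y) within img M c))
      (at (face_incl y) within face_incl ` img (bdry M) c)"
    using f[unfolded frechet_derivative_works] has_derivative_subset by blast
  from frechet_derivative_at[OF has_derivative_in_compose[OF 1 2, unfolded at], symmetric]
  show ?thesis unfolding at by (rule fun_cong)
qed

section \<open>The coframe equations\<close>

text \<open>The equation is linear in the unknown, so the difference of two solutions solves the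
  homogeneous equation and vanishes by \<open>coframe_wedge_cancel\<close>.\<close>

lemma coframe_solution_unique:
  fixes E :: "real^3^3" and V W :: "3 \<Rightarrow> real^3 \<Rightarrow> real"
  assumes "det E \<noteq> 0" "\<And>k. linear (V k)" "\<And>k. linear (W k)"
    and "\<And>i u v. (\<Sum>j\<in>UNIV. \<Sum>k\<in>UNIV. eps i j k * ((E *v u) $ j * V k v - (E *v v) $ j * V k u))
      = (\<Sum>j\<in>UNIV. \<Sum>k\<in>UNIV. eps i j k * ((E *v u) $ j * W k v - (E *v v) $ j * W k u))"
  shows "V k u = W k u"
proof -
  have "(\<Sum>j\<in>UNIV. \<Sum>k\<in>UNIV. eps i j k *
      ((E *v u) $ j * (V k v - W k v) - (E *v v) $ j * (V k u - W k u))) = 0" for i u v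
    using assms(4)[of i u v] by (simp add: algebra_simps sum_subtractf sum.distrib)
  from coframe_wedge_cancel[of E "\<lambda>k u. V k u - W k u", OF assms(1) _ this]
  show ?thesis using assms(2,3) by (simp add: linear_compose_sub)
qed

definition frame_matrix :: "('c, real^3) so3_form \<Rightarrow> 'c \<Rightarrow> real^3 \<Rightarrow> real^3^3" where
  "frame_matrix e c x = (\<chi> i m. e i c x [axis m 1])"

lemma frame_matrix_mult:
  assumes "\<And>i. is_form (M :: ('p, 'c, real^3) atlas) 1 (e i)" "x \<in> img M c"
  shows "e i c x [u] = (frame_matrix e c x *v u) $ i"
  using oneform_coords[OF assms(1)[of i] assms(2), of u]
  by (simp add: frame_matrix_def matrix_vector_mult_def mult.commute)

lemma eps_wedge_1_1:
  "eps_wedge 1 1 \<phi> \<psi> i c x [u, v] =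
    (\<Sum>j\<in>UNIV. \<Sum>k\<in>UNIV. eps i j k * (\<phi> j c x [u] * \<psi> k c x [v] - \<phi> j c x [v] * \<psi> k c x [u]))"
  unfolding eps_wedge_def wedge_1_1 ..

lemma eps_wedge_0_1:
  "eps_wedge 0 1 \<phi> \<psi> i c x [u] = (\<Sum>j\<in>UNIV. \<Sum>k\<in>UNIV. eps i j k * (\<phi> j c x [] * \<psi> k c x [u]))"
  unfolding eps_wedge_def wedge_0_1 ..

lemma eps_wedge_1_0:
  "eps_wedge 1 0 \<phi> \<psi> i c x [u] = (\<Sum>j\<in>UNIV. \<Sum>k\<in>UNIV. eps i j k * (\<phi> j c x [u] * \<psi> k c x []))"
  unfolding eps_wedge_def wedge_1_0 ..

lemma eps_wedge_1_2:
  assumes "\<And>k u v. G k c x [v, u] = - G k c x [u, v]"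
  shows "eps_wedge 1 2 e G i c x [s, u, v] = (\<Sum>j\<in>UNIV. \<Sum>k\<in>UNIV. eps i j k *
    (e j c x [s] * G k c x [u, v] - e j c x [u] * G k c x [s, v] + e j c x [v] * G k c x [s, u]))"
proof -
  have "wedge 1 2 (e j) (G k) c x [s, u, v] =
    e j c x [s] * G k c x [u, v] - e j c x [u] * G k c x [s, v] + e j c x [v] * G k c x [s, u]" for j k
    by (rule wedge_1_2) (rule assms)
  then show ?thesis unfolding eps_wedge_def by (simp only:)
qed

text \<open>Moving a one-form past a two-form costs no sign; the minus comes from exchanging two
  indices of \<open>eps\<close>. This brings the constraint on De, stated with the coframe on the
  right, to the form used for the curvature.\<close>

lemma eps_wedge_2_1:
  assumes "\<And>k u v. G k c x [v, u] = - G k c x [u, v]"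
  shows "eps_wedge 2 1 G e i c x [s, u, v] = - eps_wedge 1 2 e G i c x [s, u, v]"
proof -
  have "wedge 2 1 (G j) (e k) c x [s, u, v] =
    e k c x [s] * G j c x [u, v] - e k c x [u] * G j c x [s, v] + e k c x [v] * G j c x [s, u]" for j k
    by (rule wedge_2_1) (rule assms)
  then have "eps_wedge 2 1 G e i c x [s, u, v] = (\<Sum>j\<in>UNIV. \<Sum>k\<in>UNIV. eps i j k *
    (e k c x [s] * G j c x [u, v] - e k c x [u] * G j c x [s, v] + e k c x [v] * G j c x [s, u]))"
    unfolding eps_wedge_def by (simp only:)
  then show ?thesis
    unfolding eps_wedge_1_2[of G c x, OF assms] using exhaust_3[of i] by (auto simp: sum_3 eps_def)
qed

lemma solves_coframe_eq_unique:
  assumes e: "is_coframe (M :: ('p, 'c, real^3) atlas) e" "\<And>i. is_form M 1 (e i)" and x: "x \<in> img M c"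
    and V: "solves_coframe_eq M e \<rho> G V" and W: "solves_coframe_eq M e \<rho> G W"
  shows "V k c x [u] = W k c x [u]"
proof (rule coframe_solution_unique[of "frame_matrix e c x"])
  note fm = frame_matrix_mult[of M e, OF e(2) x, symmetric]
  show "det (frame_matrix e c x) \<noteq> 0"
    by (rule is_coframeD[OF e(1) x]) (rule fm[symmetric])
  show "linear (\<lambda>u. V k c x [u])" "linear (\<lambda>u. W k c x [u])" for k
    using V W x by (auto simp: solves_coframe_eq_def intro!: is_form_1_linear[of M])
  show "(\<Sum>j\<in>UNIV. \<Sum>k\<in>UNIV. eps i j k * ((frame_matrix e c x *v u) $ j * V k c x [v]
      - (frame_matrix e c x *v v) $ j * V k c x [u]))
    = (\<Sum>j\<in>UNIV. \<Sum>k\<in>UNIV. eps i j k * ((frame_matrix e c x *v u) $ j * W k c x [v]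
      - (frame_matrix e c x *v v) $ j * W k c x [u]))" for i u v
    unfolding fm eps_wedge_1_1[symmetric]
    using V W x by (simp add: solves_coframe_eq_def holds_on_2)
qed

text \<open>Contracting \<open>\<epsilon>\<^sub>i\<^sub>j\<^sub>k e\<^sup>j \<and> G\<^sup>k = 0\<close> with \<open>r\<close> shows that \<open>\<iota>\<^sub>r G\<close> solves the coframe equation at \<open>x\<close>.\<close>

lemma solves_coframe_eq_contraction:
  assumes e: "is_coframe (M :: ('p, 'c, real^3) atlas) e" "\<And>i. is_form M 1 (e i)" and x: "x \<in> img M c"
    and V: "solves_coframe_eq M e \<rho> G V"
    and alt: "\<And>k u v. G k c x [v, u] = - G k c x [u, v]"
    and lin: "\<And>k u. linear (\<lambda>v. G k c x [u, v])"
    and r: "\<And>i. e i c x [r] = \<rho> i c x []"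
    and con: "\<And>i s u v. eps_wedge 1 2 e G i c x [s, u, v] = 0"
  shows "V k c x [u] = G k c x [r, u]"
proof (rule coframe_solution_unique[of "frame_matrix e c x"])
  note fm = frame_matrix_mult[of M e, OF e(2) x, symmetric]
  show "det (frame_matrix e c x) \<noteq> 0"
    by (rule is_coframeD[OF e(1) x]) (rule fm[symmetric])
  show "linear (\<lambda>u. V k c x [u])" for k
    using V x by (auto simp: solves_coframe_eq_def intro!: is_form_1_linear[of M])
  show "linear (\<lambda>u. G k c x [r, u])" for k by (rule lin)
  show "(\<Sum>j\<in>UNIV. \<Sum>k\<in>UNIV. eps i j k * ((frame_matrix e c x *v u) $ j * V k c x [v]
      - (frame_matrix e c x *v v) $ j * V k c x [u]))
    = (\<Sum>j\<in>UNIV. \<Sum>k\<in>UNIV. eps i j k * ((frame_matrix e c x *v u) $ j * G k c x [r, v]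
      - (frame_matrix e c x *v v) $ j * G k c x [r, u]))" (is "?V = ?G") for i u v
  proof -
    \<comment> \<open>Antisymmetry of \<open>G\<close> cancels the average built into
      \<open>wedge 0 2\<close>, and the coefficient \<rho> is the coframe evaluated on
      \<open>r\<close>.\<close>
    have "wedge 0 2 (\<rho> j) (G k) c x [u, v] = e j c x [r] * G k c x [u, v]" for j k
      unfolding wedge_0_2 r using alt[of k u v] by simp
    then have rho: "eps_wedge 0 2 \<rho> G i c x [u, v]
        = (\<Sum>j\<in>UNIV. \<Sum>k\<in>UNIV. eps i j k * (e j c x [r] * G k c x [u, v]))"
      by (simp add: eps_wedge_def)
    have "?V = eps_wedge 0 2 \<rho> G i c x [u, v]"
      unfolding fm eps_wedge_1_1[symmetric]
      using V x by (simp add: solves_coframe_eq_def holds_on_2)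
    \<comment> \<open>With \<open>r\<close> in the first slot the constraint has three terms: e(r)
      G(u,v), minus e(u) G(r,v), plus e(v) G(r,u). Solving for the first gives the left-hand side of
      the coframe equation for the contraction.\<close>
    also have "\<dots> = ?G"
      using con[of i r u v] unfolding eps_wedge_1_2[of G c x, OF alt] rho fm
      by (simp add: algebra_simps sum_subtractf sum.distrib)
    finally show ?thesis .
  qed
qed

section \<open>Linearity and antisymmetry of curvature and De, and Cartan's formula\<close>

lemma linear_eps_wedge_1_1:
  assumes "\<And>i. linear (\<lambda>v. \<phi> i c x [v])" "\<And>i. linear (\<lambda>v. \<psi> i c x [v])"
  shows "linear (\<lambda>v. eps_wedge 1 1 \<phi> \<psi> i c x [u, v])"
  unfolding eps_wedge_1_1
  by (rule linearI)
    (simp_all add: linear_add[OF assms(1)] linear_add[OF assms(2)] linear_cmul[OF assms(1)]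
      linear_cmul[OF assms(2)] sum_3 algebra_simps)

lemma eps_wedge_1_1_alternating: "eps_wedge 1 1 \<phi> \<psi> i c x [v, u] = - eps_wedge 1 1 \<phi> \<psi> i c x [u, v]"
  unfolding eps_wedge_1_1 by (simp add: sum_negf[symmetric] algebra_simps)

lemma curvature_alternating:
  "curvature M A i c x [v, u] = - curvature M A i c x [u, v]"
  unfolding curvature_def eps_wedge_1_1_alternating[of A A i c x v u]
  by (simp add: ext_d_def)

lemma cov_d_alternating:
  "cov_d M A 1 e i c x [v, u] = - cov_d M A 1 e i c x [u, v]"
  unfolding cov_d_def eps_wedge_1_1_alternating[of A e i c x v u]
  by (simp add: ext_d_def)

lemma ext_d_0form: "ext_d M f c x [u] = frechet_derivative (\<lambda>y. f c y []) (at x within img M c) u"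
  by (simp add: ext_d_def)

text \<open>The derivative of w(r) with frozen \<open>r\<close> occurs with opposite signs in the
  two terms on the right. What remains is the derivative of \<open>w\<close> along \<open>r\<close>
  plus \<open>w\<close> applied to the derivative of \<open>r\<close>, the coordinate Lie
  derivative.\<close>

lemma cartan_formula:
  assumes op: "openin (top_of_set half_space3) (img M c)" and x: "x \<in> img M c"
    and w: "is_form M 1 w" and r: "smooth_on (img M c) (r c)"
  shows "lie_deriv M r w c x [u] = ext_d M w c x [r c x, u] + ext_d M (int_prod r w) c x [u]"
  using frechet_derivative_half_space[OF op x has_derivative_int_prod[of M c x w r, OF op x w r]]
  by (simp add: lie_deriv_def ext_d_oneform ext_d_0form)

lemma ext_d_diff_0form:
  assumes op: "openin (top_of_set half_space3) (img M c)" and x: "x \<in> img M c"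
    and f: "(\<lambda>y. f c y []) differentiable (at x within img M c)"
    and g: "(\<lambda>y. g c y []) differentiable (at x within img M c)"
  shows "ext_d M (\<lambda>c x v. f c x v - g c x v) c x [u] = ext_d M f c x [u] - ext_d M g c x [u]"
  using frechet_derivative_half_space[OF op x has_derivative_diff[OF f[unfolded frechet_derivative_works]
      g[unfolded frechet_derivative_works]]]
  by (simp add: ext_d_0form)

section \<open>Evolution, tangency and the boundary equations\<close>

text \<open>The factor \<open>a\<close> covers both uses: 1/2 for the curvature and 1 for the
  covariant differential of the coframe.\<close>

lemma linear_ext_d_plus:
  assumes op: "openin (top_of_set half_space3) (img M c)" and x: "x \<in> img M c"
    and A: "\<And>i. is_form M 1 (A i)" and e: "\<And>i. is_form M 1 (e i)"
  shows "linear (\<lambda>v. ext_d M (e i) c x [u, v] + a * eps_wedge 1 1 A e i c x [u, v])"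
proof -
  have 1: "linear (\<lambda>v. ext_d M (e i) c x [u, v])" by (rule linear_ext_d_oneform[OF op x e])
  have 2: "linear (\<lambda>v. eps_wedge 1 1 A e i c x [u, v])"
    by (intro linear_eps_wedge_1_1 is_form_1_linear[OF A x] is_form_1_linear[OF e x])
  show ?thesis
    by (rule linearI)
      (simp_all add: linear_add[OF 1] linear_add[OF 2] linear_cmul[OF 1] linear_cmul[OF 2] algebra_simps
        del: One_nat_def)
qed

lemma is_form_0_differentiable:
  assumes "is_form M 0 f" "x \<in> img M c"
  shows "(\<lambda>y. f c y []) differentiable (at x within img M c)"
  by (rule smooth_on_imp_differentiable[OF _ assms(2)]) (use assms(1) in \<open>simp add: is_form_def\<close>)

text \<open>By Cartan's formula the differential of the contraction of \<open>A\<close> cancels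
  against the one in the covariant differential. The remaining term quadratic in \<open>A\<close> is
  the contraction of half of \<open>eps\<close> A A, which completes dA to the curvature.\<close>

lemma lie_deriv_connection:
  assumes op: "openin (top_of_set half_space3) (img M c)" and x: "x \<in> img M c"
    and A: "\<And>i. is_form M 1 (A i)" and \<tau>: "is_form M 0 (\<tau> i)"
    and r: "smooth_on (img M c) (r c)"
  shows "lie_deriv M r (A i) c x [u]
      + cov_d M A 0 (\<lambda>j c x v. \<tau> j c x v - int_prod r (A j) c x v) i c x [u]
    = cov_d M A 0 \<tau> i c x [u] + curvature M A i c x [r c x, u]"
proof -
  have "(\<lambda>y. int_prod r (A i) c y []) differentiable (at x within img M c)"
    using has_derivative_int_prod[of M c x "A i" r, OF op x A r] by (auto simp: differentiable_def)
  then have d: "ext_d M (\<lambda>c x v. \<tau> i c x v - int_prod r (A i) c x v) c x [u]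
      = ext_d M (\<tau> i) c x [u] - ext_d M (int_prod r (A i)) c x [u]"
    by (rule ext_d_diff_0form[of M c x "\<tau> i", OF op x is_form_0_differentiable[OF \<tau> x]])
  show ?thesis
    unfolding cov_d_def curvature_def cartan_formula[of M c x "A i" r, OF op x A r] d
      eps_wedge_1_1 eps_wedge_1_0
    using exhaust_3[of i] by (auto simp: sum_3 eps_def int_prod_def algebra_simps)
qed

text \<open>Cartan's formula yields d\<rho> plus the contraction of de. Contracting the connection
  term of De gives two pieces: one cancels the connection term of D\<rho>, the other is the rotation
  of the coframe by the contraction of \<open>A\<close>.\<close>

lemma lie_deriv_coframe:
  assumes op: "openin (top_of_set half_space3) (img M c)" and x: "x \<in> img M c"
    and e: "\<And>i. is_form M 1 (e i)" and r: "smooth_on (img M c) (r c)"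
    and \<rho>: "\<And>i y. y \<in> img M c \<Longrightarrow> int_prod r (e i) c y [] = \<rho> i c y []"
  shows "lie_deriv M r (e i) c x [u]
      - eps_wedge 0 1 (\<lambda>j c x v. \<tau> j c x v - int_prod r (A j) c x v) e i c x [u]
    = cov_d M A 0 \<rho> i c x [u] - eps_wedge 0 1 \<tau> e i c x [u] + cov_d M A 1 e i c x [r c x, u]"
proof -
  note D = has_derivative_int_prod[of M c x "e i" r, OF op x e r]
  \<comment> \<open>The two functions agree on the chart image, so both have the derivative
    \<open>D\<close> within it, and uniqueness identifies their differentials.\<close>
  have d: "ext_d M (int_prod r (e i)) c x [u] = ext_d M (\<rho> i) c x [u]"
    unfolding ext_d_0form
    using frechet_derivative_half_space[OF op x D]
      frechet_derivative_half_space[OF op x has_derivative_within_cong[OF D x \<rho>]] by simp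
  have \<rho>x: "\<rho> j c x [] = e j c x [r c x]" for j
    using \<rho>[OF x, of j] by (simp add: int_prod_def)
  show ?thesis
    unfolding cov_d_def cartan_formula[of M c x "e i" r, OF op x e r] d
      eps_wedge_1_1 eps_wedge_1_0 eps_wedge_0_1 \<rho>x
    using exhaust_3[of i] by (auto simp: sum_3 eps_def int_prod_def algebra_simps)
qed

lemma cov_d_bdry:
  assumes op: "openin (top_of_set half_space3) (img M c)" and y: "y \<in> img (bdry M) c"
    and \<phi>: "is_form M 0 (\<phi> i)"
  shows "cov_d (bdry M) (bpull_so3 A) 0 (bpull_so3 \<phi>) i c y [w]
    = cov_d M A 0 \<phi> i c (face_incl y) [face_incl w]"
proof -
  have "face_incl y \<in> img M c" using y by (simp add: img_bdry)
  from frechet_derivative_bdry[OF op y is_form_0_differentiable[OF \<phi> this]]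
  show ?thesis
    unfolding cov_d_def ext_d_0form eps_wedge_1_0 by (simp add: bpull_so3_def bpull_def)
qed

lemma tangent_to_bdry_of_coframe:
  assumes e: "is_coframe M e" "\<And>i. is_form M 1 (e i)"
    and r: "\<And>i. holds_on M 0 (\<lambda>c x v. int_prod r (e i) c x v = \<rho> i c x v)"
    and bdry: "holds_on (bdry M) 2 (\<lambda>c y w.
      bpull (\<lambda>c x v. \<Sum>i\<in>UNIV. wedge 0 2 (\<rho> i) (eps_wedge 1 1 e e i) c x v) c y w = 0)"
  shows "tangent_to_bdry M r"
  unfolding tangent_to_bdry_def range_face_incl
proof (intro allI ballI CollectI)
  fix c y assume y: "y \<in> img (bdry M) c"
  define x where "x = face_incl y"
  have x: "x \<in> img M c" using y by (simp add: img_bdry x_def)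
  note fm = frame_matrix_mult[of M e, OF e(2) x]
  have \<rho>: "\<rho> i c x [] = e i c x [r c x]" for i
    using r[of i] x by (simp add: holds_on_0 int_prod_def)
  have ax: "face_incl (axis 1 1) = axis 1 1" "face_incl (axis 2 1) = axis 2 1"
    by (simp_all add: face_incl_def vec_eq_iff forall_3 axis_def)
  \<comment> \<open>The constraint is evaluated on the two coordinate vectors spanning the tangent
    plane of the face.\<close>
  have "0 = (\<Sum>i\<in>UNIV. wedge 0 2 (\<rho> i) (eps_wedge 1 1 e e i) c x [axis 1 1, axis 2 1])"
    using bdry[unfolded holds_on_2 bpull_def list.map, rule_format, OF y, of "axis 1 1" "axis 2 1"]
    unfolding ax x_def by (rule sym)
  \<comment> \<open>The wedge of the coframe with itself contributes two equal terms after
    relabelling \<open>j\<close> and \<open>k\<close>, whence the factor 2.\<close>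
  also have "\<dots> = 2 * (\<Sum>i\<in>UNIV. \<Sum>j\<in>UNIV. \<Sum>k\<in>UNIV.
      eps i j k * (e i c x [r c x] * e j c x [axis 1 1] * e k c x [axis 2 1]))"
    unfolding wedge_0_2 eps_wedge_1_1 \<rho>
    by (simp add: sum_3 eps_def algebra_simps diff_divide_distrib)
  also have "\<dots> = 2 * (det (frame_matrix e c x) * r c x $ 3)"
    unfolding fm eps_sum_det ..
  finally show "r c (face_incl y) $ 3 = 0"
    using is_coframeD[OF e(1) x fm] by (simp add: x_def)
qed

text \<open>A pulled-back constraint may be evaluated only on vectors tangent to the boundary.
  Tangency makes \<open>r\<close> the image of some \<open>s\<close>, so one slot can be filled with
  it.\<close>

lemma bdry_contraction:
  assumes bdry: "holds_on (bdry M) 2 (\<lambda>c y w.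
      bpull (\<lambda>c x v. G i c x v + k * eps_wedge 1 1 e e i c x v) c y w = 0)"
    and tan: "tangent_to_bdry M r" and y: "y \<in> img (bdry M) c"
    and r: "\<And>i. holds_on M 0 (\<lambda>c x v. int_prod r (e i) c x v = \<rho> i c x v)"
  shows "G i c (face_incl y) [r c (face_incl y), face_incl w]
    = - (2 * k * eps_wedge 0 1 (bpull_so3 \<rho>) (bpull_so3 e) i c y [w])"
proof -
  obtain s where s: "r c (face_incl y) = face_incl s"
    using tan y by (auto simp: tangent_to_bdry_def)
  have \<rho>: "\<rho> i c (face_incl y) [] = e i c (face_incl y) [face_incl s]" for i
    using r[of i] y by (simp add: holds_on_0 int_prod_def img_bdry s[symmetric])
  have "G i c (face_incl y) [face_incl s, face_incl w]
      + k * eps_wedge 1 1 e e i c (face_incl y) [face_incl s, face_incl w] = 0"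
    by (rule bdry[unfolded holds_on_2 bpull_def list.map, rule_format, OF y])
  \<comment> \<open>Contracting one factor of the coframe turns it into \<rho>, and the two factors
    contribute equally: this is the 2 in the boundary equations.\<close>
  moreover have "eps_wedge 1 1 e e i c (face_incl y) [face_incl s, face_incl w]
      = 2 * eps_wedge 0 1 (bpull_so3 \<rho>) (bpull_so3 e) i c y [w]"
    unfolding eps_wedge_1_1 eps_wedge_0_1
    using exhaust_3[of i] by (auto simp: sum_3 eps_def bpull_so3_def bpull_def \<rho> algebra_simps)
  ultimately show ?thesis unfolding s by simp
qed

section \<open>Chart independence and smoothness of the vector field dual to \<rho>\<close>

lemma trans_map_in_img:
  assumes M: "smooth_manifold H X M" and x: "x \<in> overlap M c d"
  shows "x \<in> img M c" "trans_map M c d x \<in> img M d"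
proof -
  have c: "openin X (cdom M c)" "homeomorphic_map (subtopology X (cdom M c)) (top_of_set (img M c)) (cmap M c)"
    using M by (auto simp: smooth_manifold_def)
  then have inj: "inj_on (cmap M c) (cdom M c)"
    using homeomorphic_imp_injective_map openin_subset[of X "cdom M c"]
    by (metis inf.absorb_iff2 topspace_subtopology)
  obtain p where "p \<in> cdom M c" "p \<in> cdom M d" "x = cmap M c p"
    using x by (auto simp: overlap_def)
  then show "x \<in> img M c" "trans_map M c d x \<in> img M d"
    using inj by (auto simp: img_def trans_map_def inv_into_f_f)
qed

text \<open>A vector is determined by its values under the coframe. Compatibility of
  \<open>e\<close> and \<rho> gives \<open>r\<close> in chart \<open>d\<close> and the transported
  \<open>r\<close> of chart \<open>c\<close> the same values, so they coincide; smoothness is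
  Cramer's rule.\<close>

lemma is_vfield_of_coframe:
  fixes M :: "('p, 'c, real^3) atlas"
  assumes M: "smooth_manifold H X M"
    and e: "is_coframe M e" "\<And>i. is_form M 1 (e i)" and \<rho>: "\<And>i. is_form M 0 (\<rho> i)"
    and r: "\<And>i. holds_on M 0 (\<lambda>c x v. int_prod r (e i) c x v = \<rho> i c x v)"
  shows "is_vfield M r"
proof -
  have fm: "e i c x [u] = (frame_matrix e c x *v u) $ i" if "x \<in> img M c" for i c x u
    by (rule frame_matrix_mult[of M e, OF e(2) that])
  have det: "det (frame_matrix e c x) \<noteq> 0" if "x \<in> img M c" for c x
    by (rule is_coframeD[OF e(1) that fm[OF that]])
  have er: "e i c x [r c x] = \<rho> i c x []" if "x \<in> img M c" for i c x
    using r[of i] that by (simp add: holds_on_0 int_prod_def)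
  have "r d (trans_map M c d x) = trans_deriv M c d x (r c x)" if x: "x \<in> overlap M c d" for c d x
  proof -
    let ?y = "trans_map M c d x"
    have xy: "x \<in> img M c" "?y \<in> img M d" using trans_map_in_img[OF M x] .
    have "e i d ?y [trans_deriv M c d x (r c x)] = e i c x [r c x]" for i
      using e(2)[of i] x unfolding is_form_def form_compatible_def by simp
    moreover have "e i d ?y [r d ?y] = \<rho> i c x []" for i
      using \<rho>[of i] x er[OF xy(2), of i] unfolding is_form_def form_compatible_def by simp
    ultimately have "frame_matrix e d ?y *v trans_deriv M c d x (r c x) = frame_matrix e d ?y *v r d ?y"
      by (simp add: vec_eq_iff fm[OF xy(2), symmetric] er[OF xy(1)])
    moreover have "inj ((*v) (frame_matrix e d ?y))"
      using det[OF xy(2)] by (simp add: inj_matrix_vector_mult invertible_det_nz)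
    ultimately show ?thesis by (simp add: inj_eq)
  qed
  moreover have "smooth_on (img M c) (r c)" for c
  proof (rule smooth_on_linear_solution[of _ "frame_matrix e c" "\<lambda>x. \<chi> i. \<rho> i c x []"])
    show "smooth_on (img M c) (\<lambda>x. frame_matrix e c x $ i $ j)" for i j
      using e(2)[of i] by (simp add: frame_matrix_def is_form_def)
    show "smooth_on (img M c) (\<lambda>x. (\<chi> i. \<rho> i c x []) $ i)" for i
      using \<rho>[of i] by (simp add: is_form_def)
    show "frame_matrix e c x *v r c x = (\<chi> i. \<rho> i c x [])" if "x \<in> img M c" for x
      using that by (simp add: vec_eq_iff fm[symmetric] er)
  qed (rule det)
  ultimately show ?thesis by (simp add: is_vfield_def)
qed

text \<open>Smoothness at each fixed time would not give joint smoothness, so Cramer's rule is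
  applied again on the product of the time interval and the chart image.\<close>

lemma is_tdep_vfield_of_coframe:
  fixes M :: "('p, 'c, real^3) atlas"
  assumes M: "smooth_manifold H X M"
    and e: "\<And>t. t \<in> I \<Longrightarrow> is_coframe M (e t)" "\<And>i. is_tdep_form I M 1 (\<lambda>t. e t i)"
    and \<rho>: "\<And>i. is_tdep_form I M 0 (\<lambda>t. \<rho> t i)"
    and R: "\<And>t i. t \<in> I \<Longrightarrow> holds_on M 0 (\<lambda>c x v. int_prod (R t) (e t i) c x v = \<rho> t i c x v)"
  shows "is_tdep_vfield I M R"
proof -
  have e': "is_form M 1 (e t i)" and \<rho>': "is_form M 0 (\<rho> t i)" if "t \<in> I" for t i
    using e(2) \<rho> that by (auto simp: is_tdep_form_def)
  have "is_vfield M (R t)" if "t \<in> I" for t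
    using is_vfield_of_coframe[OF M e(1) e' \<rho>' R] that by blast
  moreover have "smooth_on (I \<times> img M c) (\<lambda>(t, x). R t c x)" for c
  proof (rule smooth_on_linear_solution[of _ "\<lambda>(t, x). frame_matrix (e t) c x" "\<lambda>(t, x). \<chi> i. \<rho> t i c x []"])
    show "smooth_on (I \<times> img M c) (\<lambda>z. (case z of (t, x) \<Rightarrow> frame_matrix (e t) c x) $ i $ j)" for i j
      using e(2)[of i] by (simp add: frame_matrix_def is_tdep_form_def case_prod_unfold)
    show "smooth_on (I \<times> img M c) (\<lambda>z. (case z of (t, x) \<Rightarrow> \<chi> i. \<rho> t i c x []) $ i)" for i
      using \<rho>[of i] by (simp add: is_tdep_form_def case_prod_unfold)
    fix z assume "z \<in> I \<times> img M c"
    then obtain t x where z: "z = (t, x)" "t \<in> I" "x \<in> img M c" by auto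
    have fm: "e t i c x [u] = (frame_matrix (e t) c x *v u) $ i" for i u
      by (rule frame_matrix_mult[of M "e t", OF e' z(3)]) (rule z(2))
    show "det (case z of (t, x) \<Rightarrow> frame_matrix (e t) c x) \<noteq> 0"
      using is_coframeD[OF e(1)[OF z(2)] z(3) fm] by (simp add: z)
    show "(case z of (t, x) \<Rightarrow> frame_matrix (e t) c x) *v (case z of (t, x) \<Rightarrow> R t c x)
        = (case z of (t, x) \<Rightarrow> \<chi> i. \<rho> t i c x [])"
      using R[OF z(2)] z by (simp add: vec_eq_iff fm[symmetric] holds_on_0 int_prod_def)
  qed
  ultimately show ?thesis by (simp add: is_tdep_vfield_def)
qed

theorem mainTheorem5:
  fixes X :: "'p topology" and \<Sigma> :: "('p, 'c, real^3) atlas"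
    and \<alpha>\<^sub>1 \<alpha>\<^sub>2 \<alpha>\<^sub>3 \<alpha>\<^sub>4 \<alpha>\<^sub>5 :: real and I :: "real set"
    and A e \<tau> \<rho> V\<^sub>A V\<^sub>e :: "real \<Rightarrow> ('c, real^3) so3_form"
    and R :: "real \<Rightarrow> ('c, real^3) vfield"
  assumes manifold: "oriented_3manifold_with_boundary X \<Sigma>"
    and params: "\<alpha>\<^sub>1 \<noteq> \<alpha>\<^sub>2" "4 * \<alpha>\<^sub>2 * \<alpha>\<^sub>3 - \<alpha>\<^sub>5\<^sup>2 \<noteq> 0"
    and interval: "open I" "is_interval I"
    and fields:
      "\<And>i. is_tdep_form I \<Sigma> 1 (\<lambda>t. A t i)" "\<And>i. is_tdep_form I \<Sigma> 1 (\<lambda>t. e t i)"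
      "\<And>i. is_tdep_form I \<Sigma> 0 (\<lambda>t. \<tau> t i)" "\<And>i. is_tdep_form I \<Sigma> 0 (\<lambda>t. \<rho> t i)"
    and coframe: "\<And>t. t \<in> I \<Longrightarrow> is_coframe \<Sigma> (e t)"
    and constraints:
      "\<And>t i. t \<in> I \<Longrightarrow> holds_on \<Sigma> 3 (\<lambda>c x v.
         eps_wedge 1 2 (e t) (curvature \<Sigma> (A t)) i c x v = 0)"
      "\<And>t i. t \<in> I \<Longrightarrow> holds_on \<Sigma> 3 (\<lambda>c x v.
         eps_wedge 2 1 (cov_d \<Sigma> (A t) 1 (e t)) (e t) i c x v = 0)"
    and boundary_constraints:
      "\<And>t i. t \<in> I \<Longrightarrow> holds_on (bdry \<Sigma>) 2 (\<lambda>c y w.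
         bpull (\<lambda>c x v. curvature \<Sigma> (A t) i c x v
           + (2 * \<alpha>\<^sub>1 * \<alpha>\<^sub>2 - \<alpha>\<^sub>4 * \<alpha>\<^sub>5) / (4 * \<alpha>\<^sub>2 * \<alpha>\<^sub>3 - \<alpha>\<^sub>5\<^sup>2)
             * eps_wedge 1 1 (e t) (e t) i c x v) c y w = 0)"
      "\<And>t i. t \<in> I \<Longrightarrow> holds_on (bdry \<Sigma>) 2 (\<lambda>c y w.
         bpull (\<lambda>c x v. cov_d \<Sigma> (A t) 1 (e t) i c x v
           + (2 * \<alpha>\<^sub>3 * \<alpha>\<^sub>4 - \<alpha>\<^sub>1 * \<alpha>\<^sub>5) / (4 * \<alpha>\<^sub>2 * \<alpha>\<^sub>3 - \<alpha>\<^sub>5\<^sup>2)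
             * eps_wedge 1 1 (e t) (e t) i c x v) c y w = 0)"
      "\<And>t. t \<in> I \<Longrightarrow> holds_on (bdry \<Sigma>) 2 (\<lambda>c y w.
         bpull (\<lambda>c x v. \<Sum>i\<in>UNIV. wedge 0 2 (\<rho> t i) (eps_wedge 1 1 (e t) (e t) i) c x v) c y w = 0)"
    and solutions:
      "\<And>t. t \<in> I \<Longrightarrow> solves_coframe_eq \<Sigma> (e t) (\<rho> t) (curvature \<Sigma> (A t)) (V\<^sub>A t)"
      "\<And>t. t \<in> I \<Longrightarrow> solves_coframe_eq \<Sigma> (e t) (\<rho> t) (cov_d \<Sigma> (A t) 1 (e t)) (V\<^sub>e t)"
    and evolution:
      "\<And>t i. t \<in> I \<Longrightarrow> holds_on \<Sigma> 1 (\<lambda>c x v.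
         time_deriv A t i c x v = cov_d \<Sigma> (A t) 0 (\<tau> t) i c x v + V\<^sub>A t i c x v)"
      "\<And>t i. t \<in> I \<Longrightarrow> holds_on \<Sigma> 1 (\<lambda>c x v.
         time_deriv e t i c x v = cov_d \<Sigma> (A t) 0 (\<rho> t) i c x v
           - eps_wedge 0 1 (\<tau> t) (e t) i c x v + V\<^sub>e t i c x v)"
    and R_def: "\<And>t i. t \<in> I \<Longrightarrow> holds_on \<Sigma> 0 (\<lambda>c x v.
         int_prod (R t) (e t i) c x v = \<rho> t i c x v)"
  shows
    "(\<forall>t\<in>I. \<forall>W. solves_coframe_eq \<Sigma> (e t) (\<rho> t) (curvature \<Sigma> (A t)) W \<longrightarrow>
        (\<forall>i. holds_on \<Sigma> 1 (\<lambda>c x v. W i c x v = V\<^sub>A t i c x v))) \<and>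
     (\<forall>t\<in>I. \<forall>W. solves_coframe_eq \<Sigma> (e t) (\<rho> t) (cov_d \<Sigma> (A t) 1 (e t)) W \<longrightarrow>
        (\<forall>i. holds_on \<Sigma> 1 (\<lambda>c x v. W i c x v = V\<^sub>e t i c x v))) \<and>
     is_tdep_vfield I \<Sigma> R \<and>
     (\<forall>t\<in>I. tangent_to_bdry \<Sigma> (R t) \<and> (\<forall>i.
       holds_on \<Sigma> 1 (\<lambda>c x v.
         V\<^sub>A t i c x v = int_prod (R t) (curvature \<Sigma> (A t) i) c x v) \<and>
       holds_on \<Sigma> 1 (\<lambda>c x v.
         V\<^sub>e t i c x v = int_prod (R t) (cov_d \<Sigma> (A t) 1 (e t) i) c x v) \<and>
       holds_on \<Sigma> 1 (\<lambda>c x v.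
         time_deriv A t i c x v = lie_deriv \<Sigma> (R t) (A t i) c x v
           + cov_d \<Sigma> (A t) 0 (\<lambda>j c x v. \<tau> t j c x v - int_prod (R t) (A t j) c x v) i c x v) \<and>
       holds_on \<Sigma> 1 (\<lambda>c x v.
         time_deriv e t i c x v = lie_deriv \<Sigma> (R t) (e t i) c x v
           - eps_wedge 0 1 (\<lambda>j c x v. \<tau> t j c x v - int_prod (R t) (A t j) c x v) (e t) i c x v))) \<and>
     (\<forall>t\<in>I. \<forall>i.
       holds_on (bdry \<Sigma>) 1 (\<lambda>c y w.
         time_deriv (\<lambda>s. bpull_so3 (A s)) t i c y w =
           cov_d (bdry \<Sigma>) (bpull_so3 (A t)) 0 (bpull_so3 (\<tau> t)) i c y w
           - 2 * ((2 * \<alpha>\<^sub>1 * \<alpha>\<^sub>2 - \<alpha>\<^sub>4 * \<alpha>\<^sub>5) / (4 * \<alpha>\<^sub>2 * \<alpha>\<^sub>3 - \<alpha>\<^sub>5\<^sup>2))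
             * eps_wedge 0 1 (bpull_so3 (\<rho> t)) (bpull_so3 (e t)) i c y w) \<and>
       holds_on (bdry \<Sigma>) 1 (\<lambda>c y w.
         time_deriv (\<lambda>s. bpull_so3 (e s)) t i c y w =
           cov_d (bdry \<Sigma>) (bpull_so3 (A t)) 0 (bpull_so3 (\<rho> t)) i c y w
           - eps_wedge 0 1 (bpull_so3 (\<tau> t)) (bpull_so3 (e t)) i c y w
           - 2 * ((2 * \<alpha>\<^sub>3 * \<alpha>\<^sub>4 - \<alpha>\<^sub>1 * \<alpha>\<^sub>5) / (4 * \<alpha>\<^sub>2 * \<alpha>\<^sub>3 - \<alpha>\<^sub>5\<^sup>2))
             * eps_wedge 0 1 (bpull_so3 (\<rho> t)) (bpull_so3 (e t)) i c y w))"
proof -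
  have M: "smooth_manifold half_space3 X \<Sigma>"
    using manifold by (simp add: oriented_3manifold_with_boundary_def)
  then have op: "openin (top_of_set half_space3) (img \<Sigma> c)" for c
    by (simp add: smooth_manifold_def)
  have A: "is_form \<Sigma> 1 (A t i)" and e: "is_form \<Sigma> 1 (e t i)"
    and \<tau>: "is_form \<Sigma> 0 (\<tau> t i)" and \<rho>: "is_form \<Sigma> 0 (\<rho> t i)" if "t \<in> I" for t i
    using fields that by (auto simp: is_tdep_form_def)
  have R: "is_tdep_vfield I \<Sigma> R"
    by (rule is_tdep_vfield_of_coframe[OF M coframe fields(2) fields(4) R_def])
  then have R_smooth: "smooth_on (img \<Sigma> c) (R t c)" if "t \<in> I" for t c
    using that by (simp add: is_tdep_vfield_def is_vfield_def)
  have R_at: "e t i c x [R t c x] = \<rho> t i c x []" if "t \<in> I" "x \<in> img \<Sigma> c" for t i c x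
    using R_def[OF that(1)] that(2) by (simp add: holds_on_0 int_prod_def)
  have tan: "tangent_to_bdry \<Sigma> (R t)" if "t \<in> I" for t
    by (rule tangent_to_bdry_of_coframe[OF coframe[OF that] e[OF that] R_def[OF that]
          boundary_constraints(3)[OF that]])
  have VA: "V\<^sub>A t i c x [u] = curvature \<Sigma> (A t) i c x [R t c x, u]"
    if t: "t \<in> I" and x: "x \<in> img \<Sigma> c" for t i c x u
  proof (rule solves_coframe_eq_contraction[OF coframe[OF t] e[OF t] x solutions(1)[OF t]
        curvature_alternating _ R_at[OF t x]])
    show "linear (\<lambda>v. curvature \<Sigma> (A t) k c x [u, v])" for k u
      unfolding curvature_def by (rule linear_ext_d_plus[OF op x A[OF t] A[OF t]])
    show "eps_wedge 1 2 (e t) (curvature \<Sigma> (A t)) i c x [s, u, v] = 0" for i s u v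
      using constraints(1)[OF t] x unfolding holds_on_3 by blast
  qed
  have Ve: "V\<^sub>e t i c x [u] = cov_d \<Sigma> (A t) 1 (e t) i c x [R t c x, u]"
    if t: "t \<in> I" and x: "x \<in> img \<Sigma> c" for t i c x u
  proof (rule solves_coframe_eq_contraction[OF coframe[OF t] e[OF t] x solutions(2)[OF t]
        cov_d_alternating _ R_at[OF t x]])
    show "linear (\<lambda>v. cov_d \<Sigma> (A t) 1 (e t) k c x [u, v])" for k u
      using linear_ext_d_plus[OF op x A[OF t] e[OF t], where a = 1] unfolding cov_d_def mult_1 .
    \<comment> \<open>This constraint has the coframe on the right; reversing the factors changes
      only the sign, which does not affect vanishing.\<close>
    have "eps_wedge 2 1 (cov_d \<Sigma> (A t) 1 (e t)) (e t) i c x [s, u, v] = 0" for i s u v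
      using constraints(2)[OF t] x unfolding holds_on_3 by blast
    then show "eps_wedge 1 2 (e t) (cov_d \<Sigma> (A t) 1 (e t)) i c x [s, u, v] = 0" for i s u v
      unfolding eps_wedge_2_1[of "cov_d \<Sigma> (A t) 1 (e t)" c x, OF cov_d_alternating]
      by (simp only: neg_equal_0_iff_equal)
  qed
  have A_dot: "time_deriv A t i c x [u] = cov_d \<Sigma> (A t) 0 (\<tau> t) i c x [u]
      + curvature \<Sigma> (A t) i c x [R t c x, u]"
    if "t \<in> I" "x \<in> img \<Sigma> c" for t i c x u
    using evolution(1)[OF that(1), of i] that(2) VA[OF that] unfolding holds_on_1 by simp
  have e_dot: "time_deriv e t i c x [u] = cov_d \<Sigma> (A t) 0 (\<rho> t) i c x [u]
      - eps_wedge 0 1 (\<tau> t) (e t) i c x [u] + cov_d \<Sigma> (A t) 1 (e t) i c x [R t c x, u]"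
    if "t \<in> I" "x \<in> img \<Sigma> c" for t i c x u
    using evolution(2)[OF that(1), of i] that(2) Ve[OF that] unfolding holds_on_1 by metis
  \<comment> \<open>The time derivative is taken at a fixed point on fixed vectors, so it commutes
    with the pullback.\<close>
  have bdry_dot: "time_deriv (\<lambda>s. bpull_so3 (\<phi> s)) t i c y [w]
      = time_deriv \<phi> t i c (face_incl y) [face_incl w]"
    for \<phi> :: "real \<Rightarrow> ('c, real^3) so3_form" and t i c y w
    by (simp add: time_deriv_def bpull_so3_def bpull_def)
  have bdry_eps: "eps_wedge 0 1 (bpull_so3 \<phi>) (bpull_so3 \<psi>) i c y [w]
      = eps_wedge 0 1 \<phi> \<psi> i c (face_incl y) [face_incl w]"
    for \<phi> \<psi> :: "('c, real^3) so3_form" and i c y w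
    unfolding eps_wedge_0_1 by (simp add: bpull_so3_def bpull_def)
  have y: "face_incl y \<in> img \<Sigma> c" if "y \<in> img (bdry \<Sigma>) c" for y c
    using that by (simp add: img_bdry)
  \<comment> \<open>Leaving \<open>G\<close> arbitrary settles both uniqueness claims at once, with
    the curvature and with De in its place.\<close>
  have unique: "holds_on \<Sigma> 1 (\<lambda>c x v. W i c x v = V i c x v)"
    if "t \<in> I" "solves_coframe_eq \<Sigma> (e t) (\<rho> t) G W" "solves_coframe_eq \<Sigma> (e t) (\<rho> t) G V"
    for t G W V i
    unfolding holds_on_1
    by (intro allI ballI solves_coframe_eq_unique[OF coframe[OF that(1)] e[OF that(1)] _ that(2,3)])
  show ?thesis
  proof (intro conjI ballI allI impI R tan)
    show "holds_on \<Sigma> 1 (\<lambda>c x v. V\<^sub>A t i c x v = int_prod (R t) (curvature \<Sigma> (A t) i) c x v)"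
      if "t \<in> I" for t i
      using VA[OF that] unfolding holds_on_1 int_prod_def by blast
    show "holds_on \<Sigma> 1 (\<lambda>c x v. V\<^sub>e t i c x v = int_prod (R t) (cov_d \<Sigma> (A t) 1 (e t) i) c x v)"
      if "t \<in> I" for t i
      using Ve[OF that] unfolding holds_on_1 int_prod_def by blast
    show "holds_on \<Sigma> 1 (\<lambda>c x v. time_deriv A t i c x v = lie_deriv \<Sigma> (R t) (A t i) c x v
        + cov_d \<Sigma> (A t) 0 (\<lambda>j c x v. \<tau> t j c x v - int_prod (R t) (A t j) c x v) i c x v)"
      if t: "t \<in> I" for t i
      unfolding holds_on_1
    proof (intro allI ballI)
      fix c x u assume x: "x \<in> img \<Sigma> c"
      show "time_deriv A t i c x [u] = lie_deriv \<Sigma> (R t) (A t i) c x [u]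
          + cov_d \<Sigma> (A t) 0 (\<lambda>j c x v. \<tau> t j c x v - int_prod (R t) (A t j) c x v) i c x [u]"
        unfolding A_dot[OF t x]
        by (rule lie_deriv_connection[of \<Sigma> c x "A t" "\<tau> t" i "R t",
              OF op x A[OF t] \<tau>[OF t] R_smooth[OF t], symmetric])
    qed
    show "holds_on \<Sigma> 1 (\<lambda>c x v. time_deriv e t i c x v = lie_deriv \<Sigma> (R t) (e t i) c x v
        - eps_wedge 0 1 (\<lambda>j c x v. \<tau> t j c x v - int_prod (R t) (A t j) c x v) (e t) i c x v)"
      if t: "t \<in> I" for t i
      unfolding holds_on_1
    proof (intro allI ballI)
      fix c x u assume x: "x \<in> img \<Sigma> c"
      have "int_prod (R t) (e t j) c y [] = \<rho> t j c y []" if "y \<in> img \<Sigma> c" for j y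
        using R_at[OF t that] by (simp add: int_prod_def)
      from lie_deriv_coframe[of \<Sigma> c x "e t" "R t" "\<rho> t", OF op x e[OF t] R_smooth[OF t] this]
      show "time_deriv e t i c x [u] = lie_deriv \<Sigma> (R t) (e t i) c x [u]
          - eps_wedge 0 1 (\<lambda>j c x v. \<tau> t j c x v - int_prod (R t) (A t j) c x v) (e t) i c x [u]"
        unfolding e_dot[OF t x] by (simp only:)
    qed
    show "holds_on (bdry \<Sigma>) 1 (\<lambda>c y w. time_deriv (\<lambda>s. bpull_so3 (A s)) t i c y w =
        cov_d (bdry \<Sigma>) (bpull_so3 (A t)) 0 (bpull_so3 (\<tau> t)) i c y w
        - 2 * ((2 * \<alpha>\<^sub>1 * \<alpha>\<^sub>2 - \<alpha>\<^sub>4 * \<alpha>\<^sub>5) / (4 * \<alpha>\<^sub>2 * \<alpha>\<^sub>3 - \<alpha>\<^sub>5\<^sup>2))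
          * eps_wedge 0 1 (bpull_so3 (\<rho> t)) (bpull_so3 (e t)) i c y w)" if t: "t \<in> I" for t i
      unfolding holds_on_1
    proof (intro allI ballI)
      fix c y w assume b: "y \<in> img (bdry \<Sigma>) c"
      show "time_deriv (\<lambda>s. bpull_so3 (A s)) t i c y [w] =
        cov_d (bdry \<Sigma>) (bpull_so3 (A t)) 0 (bpull_so3 (\<tau> t)) i c y [w]
        - 2 * ((2 * \<alpha>\<^sub>1 * \<alpha>\<^sub>2 - \<alpha>\<^sub>4 * \<alpha>\<^sub>5) / (4 * \<alpha>\<^sub>2 * \<alpha>\<^sub>3 - \<alpha>\<^sub>5\<^sup>2))
          * eps_wedge 0 1 (bpull_so3 (\<rho> t)) (bpull_so3 (e t)) i c y [w]"
        \<comment> \<open>The evolution on \<Sigma> is read at a face point on a vector tangent to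
          the face; there the boundary constraint replaces the contracted curvature by a multiple of
          the product of \<rho> and \<open>e\<close>.\<close>
        unfolding bdry_dot A_dot[OF t y[OF b]] cov_d_bdry[of \<Sigma> c y "\<tau> t" i, OF op b \<tau>[OF t]]
          bdry_contraction[where G = "curvature \<Sigma> (A t)",
            OF boundary_constraints(1)[OF t] tan[OF t] b R_def[OF t]]
        by (rule add_uminus_conv_diff)
    qed
    show "holds_on (bdry \<Sigma>) 1 (\<lambda>c y w. time_deriv (\<lambda>s. bpull_so3 (e s)) t i c y w =
        cov_d (bdry \<Sigma>) (bpull_so3 (A t)) 0 (bpull_so3 (\<rho> t)) i c y w
        - eps_wedge 0 1 (bpull_so3 (\<tau> t)) (bpull_so3 (e t)) i c y w
        - 2 * ((2 * \<alpha>\<^sub>3 * \<alpha>\<^sub>4 - \<alpha>\<^sub>1 * \<alpha>\<^sub>5) / (4 * \<alpha>\<^sub>2 * \<alpha>\<^sub>3 - \<alpha>\<^sub>5\<^sup>2))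
          * eps_wedge 0 1 (bpull_so3 (\<rho> t)) (bpull_so3 (e t)) i c y w)" if t: "t \<in> I" for t i
      unfolding holds_on_1
    proof (intro allI ballI)
      fix c y w assume b: "y \<in> img (bdry \<Sigma>) c"
      show "time_deriv (\<lambda>s. bpull_so3 (e s)) t i c y [w] =
        cov_d (bdry \<Sigma>) (bpull_so3 (A t)) 0 (bpull_so3 (\<rho> t)) i c y [w]
        - eps_wedge 0 1 (bpull_so3 (\<tau> t)) (bpull_so3 (e t)) i c y [w]
        - 2 * ((2 * \<alpha>\<^sub>3 * \<alpha>\<^sub>4 - \<alpha>\<^sub>1 * \<alpha>\<^sub>5) / (4 * \<alpha>\<^sub>2 * \<alpha>\<^sub>3 - \<alpha>\<^sub>5\<^sup>2))
          * eps_wedge 0 1 (bpull_so3 (\<rho> t)) (bpull_so3 (e t)) i c y [w]"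
        unfolding bdry_dot e_dot[OF t y[OF b]] cov_d_bdry[of \<Sigma> c y "\<rho> t" i, OF op b \<rho>[OF t]]
          bdry_contraction[where G = "cov_d \<Sigma> (A t) 1 (e t)",
            OF boundary_constraints(2)[OF t] tan[OF t] b R_def[OF t]]
          bdry_eps[of "\<tau> t"]
        by (rule add_uminus_conv_diff)
    qed
  qed (use unique solutions in blast)+
qed

end
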